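(* Let $a,b,c\in\mathbb{C}$ satisfy $a\notin\mathbb{Z}_{\le -1}$, $c-b\notin\mathbb{Z}_{\le -1}$, $b\notin\mathbb{Z}_{\le 0}$, $c\notin\mathbb{Z}_{\le 0}$, $c-a\notin\mathbb{Z}_{\le 0}$, let $z\in(-\infty,1)$, and suppose ${}_2F_1(a,b;c;z)\neq 0$. Let $\mathcal{E}_n(a,b,c;z)$ be the truncation error of Gauss's continued fraction (defined in the context). Then, as $n\to\infty$, $$\mathcal{E}_n(a,b,c;z)\sim \frac{2\pi}{{}_2F_1(a,b;c;z)^2}\cdot\frac{\Gamma(c)\,\Gamma(c+1)}{\Gamma(a+1)\,\Gamma(b)\,\Gamma(c-a)\,\Gamma(c-b+1)}\cdot\frac{z\,(1-z)^{c-a-b}}{(1+\sqrt{1-z})^{2(c+1)}}\left\{\frac{z}{(1+\sqrt{1-z})^2}\right\}^{n}.$$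
   Context: ${}_2F_1(a,b;c;z)$ denotes Gauss's hypergeometric series $\sum_{k\ge 0}\frac{(a)_k(b)_k}{(c)_k\,k!}z^k$ and its analytic continuation to $\mathbb{C}\setminus[1,\infty)$. Put $R(0):=1$ and, for $m\in\mathbb{Z}_{\ge 0}$, $$R(2m+1):=-\frac{(m+b)(m+c-a)z}{(2m+c)(2m+c+1)},\qquad R(2m+2):=-\frac{(m+a+1)(m+c-b+1)z}{(2m+c+1)(2m+c+2)}.$$ The $n$-th truncation (approximant) of Gauss's continued fraction is the finite continued fraction $$K_n:=\cfrac{R(0)}{1+\cfrac{R(1)}{1+\cfrac{\ddots}{1+\cfrac{R(n)}{1}}}},$$ and the truncation error is $$\mathcal{E}_n(a,b,c;z):=\frac{{}_2F_1(a+1,b;c+1;z)}{{}_2F_1(a,b;c;z)}-K_n .$$ For sequences $\{\alpha_n\},\{\beta_n\}$, the notation $\alpha_n\sim\beta_n$ means $\alpha_n/\beta_n=1+O(n^{-1/2})$ as $n\to\infty$; when $\beta_n=0$ for all large $n$ (the trivial case $z=0$) it is read as $\alpha_n=\beta_n(1+O(n^{-1/2}))$, i.e. $\alpha_n=0$ for all large $n$. Powers of positive reals with complex exponent are $x^s=e^{s\log x}$ with real logarithm; square roots of positive reals are positive. *)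

theory Defs
  imports "HOL-Complex_Analysis.Complex_Analysis" "HOL-Library.Landau_Symbols"
begin

definition hyp2f1_series :: "complex \<Rightarrow> complex \<Rightarrow> complex \<Rightarrow> complex \<Rightarrow> complex" where
  "hyp2f1_series a b c z =
     (\<Sum>k. pochhammer a k * pochhammer b k / (pochhammer c k * fact k) * z ^ k)"

lemma hyp2f1_series_eq_eval_fps:
  "hyp2f1_series a b c z = eval_fps (fps_hypergeo [a, b] [c] 1) z"
  by (simp add: hyp2f1_series_def eval_fps_def)

(* The holomorphic function on the plane cut along [1, \<infinity>) that extends the series from the
   unit disc.  By the identity theorem any two choices agree on the cut plane; the value
   on the cut itself is unspecified. *)
definition hyp2f1 :: "complex \<Rightarrow> complex \<Rightarrow> complex \<Rightarrow> complex \<Rightarrow> complex" where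
  "hyp2f1 a b c =
     (SOME f. f holomorphic_on (- (complex_of_real ` {1..})) \<and>
              (\<forall>z\<in>ball 0 1. f z = hyp2f1_series a b c z))"

fun gauss_cf_coeff :: "complex \<Rightarrow> complex \<Rightarrow> complex \<Rightarrow> complex \<Rightarrow> nat \<Rightarrow> complex" where
  "gauss_cf_coeff a b c z 0 = 1"
| "gauss_cf_coeff a b c z (Suc j) =
     (let m = of_nat (j div 2) in
      if even j
      then - ((m + b) * (m + c - a) * z) / ((2 * m + c) * (2 * m + c + 1))
      else - ((m + a + 1) * (m + c - b + 1) * z) / ((2 * m + c + 1) * (2 * m + c + 2)))"

lemma gauss_cf_coeff_odd:
  "gauss_cf_coeff a b c z (2 * m + 1) =
     - ((of_nat m + b) * (of_nat m + c - a) * z) /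
       ((2 * of_nat m + c) * (2 * of_nat m + c + 1))"
  by (simp add: Let_def)

lemma gauss_cf_coeff_even:
  "gauss_cf_coeff a b c z (2 * m + 2) =
     - ((of_nat m + a + 1) * (of_nat m + c - b + 1) * z) /
       ((2 * of_nat m + c + 1) * (2 * of_nat m + c + 2))"
  by (simp add: Let_def)

(* R 0 / (1 + R 1 / (1 + ... / (1 + R n / 1))), evaluated from the innermost fraction
   outwards.  HOL's x / 0 = 0 intervenes if some inner denominator vanishes. *)
definition finite_cf :: "(nat \<Rightarrow> complex) \<Rightarrow> nat \<Rightarrow> complex" where
  "finite_cf R n = foldr (\<lambda>k t. R k / (1 + t)) [0..<Suc n] 0"

lemma finite_cf_2: "finite_cf R 2 = R 0 / (1 + R 1 / (1 + R 2 / 1))"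
  by (simp add: finite_cf_def numeral_2_eq_2)

definition gauss_cf_error :: "nat \<Rightarrow> complex \<Rightarrow> complex \<Rightarrow> complex \<Rightarrow> complex \<Rightarrow> complex" where
  "gauss_cf_error n a b c z =
     hyp2f1 (a + 1) b (c + 1) z / hyp2f1 a b c z - finite_cf (gauss_cf_coeff a b c z) n"

(* Not the library's asymptotic equivalence: the rate O(n^(-1/2)) is part of the relation,
   and a comparison sequence that vanishes eventually is allowed. *)
definition asymp_half :: "(nat \<Rightarrow> complex) \<Rightarrow> (nat \<Rightarrow> complex) \<Rightarrow> bool" where
  "asymp_half \<alpha> \<beta> \<longleftrightarrow>
     (if \<forall>\<^sub>F n in sequentially. \<beta> n = 0
      then \<forall>\<^sub>F n in sequentially. \<alpha> n = 0
      else (\<lambda>n. \<alpha> n / \<beta> n - 1) \<in> O(\<lambda>n. of_real (real n powr (- 1 / 2))))"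

end

theory Submission
  imports Defs "HOL-Real_Asymp.Real_Asymp"
begin

text \<open>
  Put \<open>f n = 2F1 (a + \<lceil>n/2\<rceil>) (b + \<lfloor>n/2\<rfloor>) (c + n) z\<close>, \<open>s = sqrt (1 - z)\<close> and
  \<open>w = (1 - s) / (1 + s)\<close>.  Gauss's contiguous relations say \<open>f n = f (n + 1) + R (n + 1) * f (n + 2)\<close>,
  and a Casoratian argument turns the truncation error into
  \<open>(\<Prod>i=1..n+1. - R i) * f (n + 2) / (f 0 * B n)\<close>, where the denominators \<open>B n\<close> satisfy
  \<open>B n * f (n + 1) + R (n + 1) * B (n - 1) * f (n + 2) = f 0\<close>.  As \<open>R (n + 1) * f (n + 2) / f n\<close> tends
  to \<open>- w\<close> with \<open>\<bar>w\<bar> < 1\<close>, the last identity is a contraction for \<open>B n * f (n + 1)\<close>, whose limit is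
  \<open>f 0 / (1 - w)\<close>.  It remains to know the product of the \<open>R i\<close> (Gamma function) and \<open>f n\<close> itself,
  which for large \<open>n\<close> is a quotient of Euler integrals to which Laplace's method applies.  The same
  integrals, pulled back through the contiguous relations, continue \<open>2F1\<close> to the cut plane for all
  parameters.
\<close>

section \<open>Convergence at rate \<open>n\<close> to the power \<open>- 1 / 2\<close>\<close>

text \<open>Replacing the coefficients by their limit - z / 4 turns the recurrence into
  \<open>f n = f (n + 1) - z / 4 * f (n + 2)\<close>, whose solutions (for z nonzero) grow
  geometrically with ratio 2 / (1 + s) = 1 + w or 2 / (1 - s) = (1 + w) / w. So w is the quotient of
  the two characteristic ratios, and z < 1 enters as s > 0, which means \<bar>w\<bar> < 1. The
  analytic input is that the hypergeometric f follows the smaller ratio; this is what makes the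
  recursion for the denominators contract.

  The exponent - 1 / 2 is born in Laplace's method: a Lipschitz bound at the saddle point gives an
  error of order 1 / m, to be compared with a main term of order m^(-1/2).

  Two obstacles shape the rest. Among the values f k only f 0 is assumed to be nonzero, and inner
  denominators of a truncation may vanish, so that the truncation has to be identified with a
  quotient of continuants for large n only. And Euler's integral has a continuous integrand only for
  large parameters, so existence of the continuation and the asymptotics are proved far out and then
  carried back.\<close>

definition half_rate :: "(nat \<Rightarrow> complex) \<Rightarrow> complex \<Rightarrow> bool" where
  "half_rate u L \<longleftrightarrow> (\<lambda>n. norm (u n - L)) \<in> O(\<lambda>n. real n powr (-1/2))"

lemma half_rate_iff_bound:
  "half_rate u L \<longleftrightarrow> (\<exists>K. \<forall>\<^sub>F n in sequentially. norm (u n - L) \<le> K * real n powr (-1/2))"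
proof
  assume "half_rate u L"
  then show "\<exists>K. \<forall>\<^sub>F n in sequentially. norm (u n - L) \<le> K * real n powr (-1/2)"
    unfolding half_rate_def by (elim landau_o.bigE) auto
next
  assume "\<exists>K. \<forall>\<^sub>F n in sequentially. norm (u n - L) \<le> K * real n powr (-1/2)"
  then show "half_rate u L"
    unfolding half_rate_def by (auto intro: bigoI)
qed

lemma half_rate_const [intro]: "half_rate (\<lambda>_. L) L"
  by (simp add: half_rate_def)

lemma half_rate_cong:
  assumes "\<forall>\<^sub>F n in sequentially. u n = v n" "L = M"
  shows "half_rate u L \<longleftrightarrow> half_rate v M"
  unfolding half_rate_def using assms
  by (intro landau_o.big.in_cong) (auto elim: eventually_mono)

lemma half_rate_tendsto:
  assumes "half_rate u L"
  shows "u \<longlonglongrightarrow> L"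
proof -
  obtain K where K: "\<forall>\<^sub>F n in sequentially. norm (u n - L) \<le> K * real n powr (-1/2)"
    using assms unfolding half_rate_iff_bound by blast
  have "(\<lambda>n. K * real n powr (-1/2)) \<longlonglongrightarrow> 0" by real_asymp
  then have "(\<lambda>n. u n - L) \<longlonglongrightarrow> 0"
    by (rule Lim_null_comparison[OF K])
  then show ?thesis
    by (simp add: LIM_zero_iff)
qed

text \<open>The complex form is the one in which \<open>asymp_half\<close> is stated, and in which
  sums and products of differences can be estimated by the Landau rules.\<close>

lemma half_rate_complex:
  "half_rate u L \<longleftrightarrow> (\<lambda>n. u n - L) \<in> O(\<lambda>n. complex_of_real (real n powr (-1/2)))"
  unfolding half_rate_def by (simp add: bigo_def)

lemma half_rate_mult:
  assumes "half_rate u L" "half_rate v M"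
  shows "half_rate (\<lambda>n. u n * v n) (L * M)"
proof -
  have "v \<in> O(\<lambda>_. 1)"
    using half_rate_tendsto[OF assms(2)] by (intro bigoI_tendsto[where c = M]) auto
  then have "(\<lambda>n. (u n - L) * v n + L * (v n - M)) \<in> O(\<lambda>n. complex_of_real (real n powr (-1/2)))"
    using assms unfolding half_rate_complex
    by (intro sum_in_bigo) (auto dest: landau_o.big.mult)
  then show ?thesis
    unfolding half_rate_complex by (simp add: algebra_simps)
qed

lemma half_rate_add:
  assumes "half_rate u L" "half_rate v M"
  shows "half_rate (\<lambda>n. u n + v n) (L + M)"
  using sum_in_bigo(1)[OF assms[unfolded half_rate_complex]]
  unfolding half_rate_complex by (simp add: algebra_simps)

lemma half_rate_inverse:
  assumes "half_rate u L" "L \<noteq> 0"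
  shows "half_rate (\<lambda>n. inverse (u n)) (inverse L)"
proof -
  have lim: "(\<lambda>n. inverse (u n)) \<longlonglongrightarrow> inverse L"
    using half_rate_tendsto[OF assms(1)] assms(2) by (intro tendsto_intros)
  have "(\<lambda>n. inverse (u n)) \<in> O(\<lambda>_. 1)"
    using lim by (intro bigoI_tendsto[where c = "inverse L"]) auto
  then have O: "(\<lambda>n. (u n - L) * ((- inverse L) * inverse (u n)))
      \<in> O(\<lambda>n. complex_of_real (real n powr (-1/2)) * 1)"
    using assms unfolding half_rate_complex by (intro landau_o.big.mult) auto
  have "\<forall>\<^sub>F n in sequentially. u n \<noteq> 0"
    using half_rate_tendsto[OF assms(1)] assms(2) by (rule tendsto_imp_eventually_ne)
  then have eq: "\<forall>\<^sub>F n in sequentially.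
      (u n - L) * ((- inverse L) * inverse (u n)) = inverse (u n) - inverse L"
  proof eventually_elim
    case (elim n)
    then show ?case using inverse_diff_inverse[of "u n" L] assms(2) by (simp add: mult_ac)
  qed
  from O show ?thesis
    unfolding half_rate_complex mult_1_right landau_o.big.in_cong[OF eq] .
qed

lemma half_rate_divide:
  assumes "half_rate u L" "half_rate v M" "M \<noteq> 0"
  shows "half_rate (\<lambda>n. u n / v n) (L / M)"
  using half_rate_mult[OF assms(1) half_rate_inverse[OF assms(2,3)]]
  by (simp add: divide_inverse)

lemma half_rate_offset:
  assumes "half_rate u L"
  shows "half_rate (\<lambda>n. u (n + k)) L"
proof -
  have "filterlim (\<lambda>n. n + k) at_top sequentially" by (rule filterlim_add_const_nat_at_top)
  then have "(\<lambda>n. norm (u (n + k) - L)) \<in> O(\<lambda>n. real (n + k) powr (-1/2))"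
    using assms unfolding half_rate_def by (rule landau_o.big.compose[rotated])
  moreover have "(\<lambda>n. real (n + k) powr (-1/2)) \<in> O(\<lambda>n. real n powr (-1/2))"
    by real_asymp
  ultimately show ?thesis
    unfolding half_rate_def by (rule landau_o.big_trans)
qed

lemma half_rate_of_offset:
  assumes "half_rate (\<lambda>n. u (n + k)) L"
  shows "half_rate u L"
proof -
  have "(\<lambda>n. norm (u (n - k + k) - L)) \<in> O(\<lambda>n. real (n - k) powr (-1/2))"
    using assms unfolding half_rate_def
    by (rule landau_o.big.compose) (rule filterlim_minus_const_nat_at_top)
  \<comment> \<open>Subtraction on naturals is truncated; from k on it agrees with the real
    difference, to which \<open>real_asymp\<close> applies.\<close>
  moreover have "(\<lambda>n. real (n - k) powr (-1/2)) \<in> O(\<lambda>n. (real n - real k) powr (-1/2))"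
    by (intro bigoI[of _ 1] eventually_mono[OF eventually_ge_at_top[of k]]) (auto simp: of_nat_diff)
  moreover have "(\<lambda>n. (real n - real k) powr (-1/2)) \<in> O(\<lambda>n. real n powr (-1/2))"
    by real_asymp
  ultimately have "(\<lambda>n. norm (u (n - k + k) - L)) \<in> O(\<lambda>n. real n powr (-1/2))"
    by (meson landau_o.big_trans)
  moreover have eq: "\<forall>\<^sub>F n in sequentially. norm (u (n - k + k) - L) = norm (u n - L)"
    by (intro eventually_mono[OF eventually_ge_at_top[of k]]) auto
  ultimately show ?thesis
    unfolding half_rate_def landau_o.big.in_cong[OF eq] by simp
qed

lemma half_rate_odd:
  assumes "half_rate u L"
  shows "half_rate (\<lambda>m. u (2 * m + 1)) L"
proof -
  have "filterlim (\<lambda>m::nat. 2 * m + 1) at_top sequentially"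
    by (intro filterlim_subseq strict_monoI) auto
  then have "(\<lambda>m. norm (u (2 * m + 1) - L)) \<in> O(\<lambda>m. real (2 * m + 1) powr (-1/2))"
    using assms unfolding half_rate_def by (rule landau_o.big.compose[rotated])
  moreover have "(\<lambda>m. real (2 * m + 1) powr (-1/2)) \<in> O(\<lambda>m. real m powr (-1/2))"
    by real_asymp
  ultimately show ?thesis
    unfolding half_rate_def by (rule landau_o.big_trans)
qed

text \<open>Both the coefficients of the fraction and the parameters of its numerators are given by
  separate formulas for even and odd index, so limits are established along each parity.\<close>

lemma half_rate_parity:
  assumes "half_rate (\<lambda>m. u (2 * m)) L" "half_rate (\<lambda>m. u (2 * m + 1)) L"
  shows "half_rate u L"
proof -
  obtain K1 N1 where 1: "\<And>m. m \<ge> N1 \<Longrightarrow> norm (u (2 * m) - L) \<le> K1 * real m powr (-1/2)"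
    using assms(1) unfolding half_rate_iff_bound eventually_sequentially by blast
  obtain K2 N2 where 2: "\<And>m. m \<ge> N2 \<Longrightarrow> norm (u (2 * m + 1) - L) \<le> K2 * real m powr (-1/2)"
    using assms(2) unfolding half_rate_iff_bound eventually_sequentially by blast
  define K where "K = max \<bar>K1\<bar> \<bar>K2\<bar>"
  have "norm (u n - L) \<le> K * 2 * real n powr (-1/2)" if n: "n \<ge> 2 * N1 + 2 * N2 + 2" for n
  proof -
    have m: "n div 2 \<ge> N1" "n div 2 \<ge> N2" "n div 2 \<ge> 1" using n by linarith+
    have "norm (u n - L) \<le> K * real (n div 2) powr (-1/2)"
    proof (cases "even n")
      case True
      then have "norm (u n - L) \<le> K1 * real (n div 2) powr (-1/2)" using 1[OF m(1)] by simp
      also have "\<dots> \<le> K * real (n div 2) powr (-1/2)" by (intro mult_right_mono) (auto simp: K_def)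
      finally show ?thesis .
    next
      case False
      then have "norm (u n - L) \<le> K2 * real (n div 2) powr (-1/2)" using 2[OF m(2)]
        by (metis odd_two_times_div_two_succ)
      also have "\<dots> \<le> K * real (n div 2) powr (-1/2)" by (intro mult_right_mono) (auto simp: K_def)
      finally show ?thesis .
    qed
    \<comment> \<open>From n = 2 on, \<open>n div 2\<close> is at least n / 4; the exponent - 1 / 2
      turns the 4 into a factor 2.\<close>
    also have "\<dots> \<le> K * (real n / 4) powr (-1/2)"
      using n by (intro mult_left_mono powr_mono2') (auto simp: K_def)
    also have "(real n / 4) powr (-1/2) = 2 * real n powr (-1/2)"
    proof -
      have "(4::real) powr (-1/2) = 1/2"
        using powr_half_sqrt[of "4::real"] by (simp add: powr_minus_divide)
      then have "inverse ((4::real) powr (-1/2)) = 2" by (simp only: inverse_eq_divide) simp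
      moreover have "(real n / 4) powr (-1/2) = real n powr (-1/2) * inverse (4 powr (-1/2))"
        unfolding divide_inverse[symmetric] by (rule powr_divide)
      ultimately show ?thesis by simp
    qed
    finally show ?thesis by (simp add: mult.assoc)
  qed
  then show ?thesis
    unfolding half_rate_iff_bound eventually_sequentially by blast
qed

text \<open>Upgrades a bare limit to one with a rate: n^(-3/2) is dominated by the increments of
  n^(-1/2), so the bound on the increments of u telescopes, and letting the upper index tend to
  infinity bounds the distance to L.\<close>

lemma half_rate_of_small_increments:
  assumes lim: "u \<longlonglongrightarrow> L"
    and inc: "(\<lambda>n. norm (u (Suc n) - u n)) \<in> O(\<lambda>n. real n powr (-3/2))"
  shows "half_rate u L"
proof -
  have "(\<lambda>n. real n powr (-3/2)) \<in> O(\<lambda>n. real n powr (-1/2) - real (Suc n) powr (-1/2))"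
    by real_asymp
  then have "(\<lambda>n. norm (u (Suc n) - u n)) \<in> O(\<lambda>n. real n powr (-1/2) - real (Suc n) powr (-1/2))"
    using inc landau_o.big_trans by blast
  then obtain K where "\<forall>\<^sub>F n in sequentially.
      norm (norm (u (Suc n) - u n)) \<le> K * norm (real n powr (-1/2) - real (Suc n) powr (-1/2))"
    by (auto simp: bigo_def)
  then obtain N where N: "\<And>n. n \<ge> N \<Longrightarrow>
      norm (u (Suc n) - u n) \<le> K * \<bar>real n powr (-1/2) - real (Suc n) powr (-1/2)\<bar>"
    unfolding eventually_sequentially by auto
  have step: "norm (u (Suc n) - u n) \<le> \<bar>K\<bar> * (real n powr (-1/2) - real (Suc n) powr (-1/2))"
    if n: "n \<ge> max 1 N" for n
  proof -
    have "real (Suc n) powr (-1/2) \<le> real n powr (-1/2)"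
      using n by (intro powr_mono2') auto
    moreover have "norm (u (Suc n) - u n) \<le> K * \<bar>real n powr (-1/2) - real (Suc n) powr (-1/2)\<bar>"
      using n N by auto
    moreover have "\<dots> \<le> \<bar>K\<bar> * \<bar>real n powr (-1/2) - real (Suc n) powr (-1/2)\<bar>"
      by (intro mult_right_mono) auto
    ultimately show ?thesis by simp
  qed
  have tele: "norm (u (n + k) - u n) \<le> \<bar>K\<bar> * (real n powr (-1/2) - real (n + k) powr (-1/2))"
    if n: "n \<ge> max 1 N" for n k
  proof (induction k)
    case (Suc k)
    have "norm (u (n + Suc k) - u n) \<le> norm (u (Suc (n + k)) - u (n + k)) + norm (u (n + k) - u n)"
      using norm_triangle_ineq[of "u (Suc (n + k)) - u (n + k)" "u (n + k) - u n"] by simp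
    also have "\<dots> \<le> \<bar>K\<bar> * (real (n + k) powr (-1/2) - real (Suc (n + k)) powr (-1/2))
        + \<bar>K\<bar> * (real n powr (-1/2) - real (n + k) powr (-1/2))"
      using Suc step[of "n + k"] n by (intro add_mono) auto
    finally show ?case by (simp add: algebra_simps)
  qed auto
  have "norm (u n - L) \<le> \<bar>K\<bar> * real n powr (-1/2)" if n: "n \<ge> max 1 N" for n
  proof -
    have "(\<lambda>k. u (n + k)) \<longlonglongrightarrow> L"
      using lim by (subst add.commute) (rule LIMSEQ_ignore_initial_segment)
    then have "(\<lambda>k. norm (u (n + k) - u n)) \<longlonglongrightarrow> norm (L - u n)"
      by (intro tendsto_intros)
    then have "norm (L - u n) \<le> \<bar>K\<bar> * real n powr (-1/2)"
    proof (rule LIMSEQ_le_const2, intro exI allI impI)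
      fix k
      show "norm (u (n + k) - u n) \<le> \<bar>K\<bar> * real n powr (-1/2)"
        using tele[OF n, of k] by (rule order.trans) (intro mult_left_mono, auto)
    qed
    then show ?thesis by (simp add: norm_minus_commute)
  qed
  then show ?thesis
    unfolding half_rate_iff_bound eventually_sequentially by blast
qed

text \<open>The limit is the fixed point of x = C - r x. The error contracts by a factor below 1 at
  each step and receives a new contribution of order n^(-1/2); as n^(-1/2) decays more slowly than
  any geometric sequence, this order persists.\<close>

lemma half_rate_affine_recursion:
  assumes rec: "\<forall>\<^sub>F n in sequentially. x (Suc n) = C - \<rho> n * x n"
    and \<rho>: "half_rate \<rho> r" and r: "norm r < 1"
  shows "half_rate x (C / (1 + r))"
proof -
  define e where "e n = norm (x n - C / (1 + r))" for n
  have r1: "1 + r \<noteq> 0" using r by (metis add_eq_0_iff2 norm_minus_cancel norm_one less_irrefl)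
  \<comment> \<open>q bounds the contraction factor for large n; the gap up to q' absorbs the new
    contribution, and q' < 1 leaves room for the decrease from n^(-1/2) to (n + 1)^(-1/2).\<close>
  obtain q q' where q: "norm r < q" "q < q'" "q' < 1"
    using dense[OF r] dense by blast
  obtain K N1 where K: "\<And>n. n \<ge> N1 \<Longrightarrow> norm (\<rho> n - r) \<le> K * real n powr (-1/2)"
    using \<rho> unfolding half_rate_iff_bound eventually_sequentially by blast
  have "\<forall>\<^sub>F n in sequentially. norm (\<rho> n) < q"
    using tendsto_norm[OF half_rate_tendsto[OF \<rho>]] q(1) by (rule order_tendstoD)
  then obtain N2 where N2: "\<And>n. n \<ge> N2 \<Longrightarrow> norm (\<rho> n) < q"
    unfolding eventually_sequentially by blast
  obtain N3 where N3: "\<And>n. n \<ge> N3 \<Longrightarrow> x (Suc n) = C - \<rho> n * x n"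
    using rec unfolding eventually_sequentially by blast
  have "((\<lambda>n. real (Suc n) powr (-1/2) / real n powr (-1/2)) \<longlongrightarrow> 1) sequentially"
    by real_asymp
  then have "\<forall>\<^sub>F n in sequentially. q' < real (Suc n) powr (-1/2) / real n powr (-1/2)"
    using q(3) by (rule order_tendstoD)
  then obtain N4 where N4: "\<And>n. n \<ge> N4 \<Longrightarrow> q' < real (Suc n) powr (-1/2) / real n powr (-1/2)"
    unfolding eventually_sequentially by blast
  define N where "N = N1 + N2 + N3 + N4 + 1"
  define K' where "K' = \<bar>K\<bar> * norm (C / (1 + r))"
  have est: "e (Suc n) \<le> q * e n + K' * real n powr (-1/2)" if n: "n \<ge> N" for n
  proof -
    have "x (Suc n) - C / (1 + r) = - \<rho> n * (x n - C / (1 + r)) - (\<rho> n - r) * (C / (1 + r))"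
    proof -
      define l where "l = C / (1 + r)"
      have "C - l = r * l" using r1 by (simp add: l_def field_simps)
      moreover have "x (Suc n) = C - \<rho> n * x n" using N3[of n] n by (simp add: N_def)
      ultimately have "x (Suc n) - l = - \<rho> n * (x n - l) - (\<rho> n - r) * l"
        by (simp add: left_diff_distrib right_diff_distrib)
      then show ?thesis by (simp only: l_def)
    qed
    then have "e (Suc n) \<le> norm (\<rho> n) * e n + norm (\<rho> n - r) * norm (C / (1 + r))"
      using norm_triangle_ineq4[of "- \<rho> n * (x n - C / (1 + r))" "(\<rho> n - r) * (C / (1 + r))"]
      by (simp only: e_def norm_mult norm_minus_cancel)
    also have "\<dots> \<le> q * e n + (\<bar>K\<bar> * real n powr (-1/2)) * norm (C / (1 + r))"
    proof (intro add_mono mult_right_mono)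
      have "norm (\<rho> n - r) \<le> K * real n powr (-1/2)" using K n by (simp add: N_def)
      also have "\<dots> \<le> \<bar>K\<bar> * real n powr (-1/2)" by (intro mult_right_mono) auto
      finally show "norm (\<rho> n - r) \<le> \<bar>K\<bar> * real n powr (-1/2)" .
    qed (use N2[of n] n in \<open>auto simp: N_def e_def\<close>)
    finally show ?thesis by (simp add: K'_def mult_ac)
  qed
  \<comment> \<open>The first entry starts the induction; the second makes
    \<open>q * M + K' \<le> q' * M\<close>, which is the induction step.\<close>
  define M where "M = max (e N / real N powr (-1/2)) (K' / (q' - q))"
  have "e n \<le> M * real n powr (-1/2)" if "n \<ge> N" for n
    using that
  proof (induction n rule: dec_induct)
    case base
    have "real N powr (-1/2) > 0" by (simp add: N_def)
    moreover have "e N / real N powr (-1/2) \<le> M" by (simp add: M_def)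
    ultimately show ?case by (simp only: pos_divide_le_eq)
  next
    case (step n)
    have pos: "real n powr (-1/2) > 0" using step by (simp add: N_def)
    have q0: "0 < q" using q norm_ge_zero by (rule_tac order.strict_trans1)
    have "K' / (q' - q) \<le> M" by (simp add: M_def)
    then have "K' \<le> M * (q' - q)" using q by (simp add: pos_divide_le_eq)
    then have M: "q * M + K' \<le> q' * M" by (simp add: algebra_simps)
    have "0 \<le> K' / (q' - q)" using q by (simp add: K'_def)
    then have M0: "M \<ge> 0" using \<open>K' / (q' - q) \<le> M\<close> by simp
    have "e (Suc n) \<le> q * e n + K' * real n powr (-1/2)" using est step by simp
    also have "\<dots> \<le> q * (M * real n powr (-1/2)) + K' * real n powr (-1/2)"
      using step q0 by (intro add_right_mono mult_left_mono) auto
    also have "\<dots> = (q * M + K') * real n powr (-1/2)" by (simp add: algebra_simps)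
    also have "\<dots> \<le> q' * M * real n powr (-1/2)" using M by (intro mult_right_mono) auto
    also have "\<dots> \<le> M * real (Suc n) powr (-1/2)"
    proof -
      have "q' * real n powr (-1/2) \<le> real (Suc n) powr (-1/2)"
        using N4[of n] step(1) pos by (simp add: N_def pos_less_divide_eq)
      from mult_left_mono[OF this M0] show ?thesis by (simp only: mult_ac)
    qed
    finally show ?case .
  qed
  then show ?thesis
    unfolding half_rate_iff_bound eventually_sequentially e_def by blast
qed

section \<open>Truncation errors of continued fractions\<close>

text \<open>The denominator of the continued fraction with partial numerators
  \<open>R (k + 1), \<dots>, R (k + j - 1)\<close>; the index is shifted by one so that both initial values are 1.\<close>

fun continuant :: "(nat \<Rightarrow> complex) \<Rightarrow> nat \<Rightarrow> nat \<Rightarrow> complex" where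
  "continuant R k 0 = 1"
| "continuant R k (Suc 0) = 1"
| "continuant R k (Suc (Suc j)) = continuant R k (Suc j) + R (Suc (k + j)) * continuant R k j"

text \<open>A truncation is evaluated by peeling off its outermost fraction, whereas the defining
  recursion appends a coefficient at the inner end; continuants can be expanded at either
  end.\<close>

lemma continuant_left:
  "continuant R k (Suc (Suc j)) =
     continuant R (Suc k) (Suc j) + R (Suc k) * continuant R (Suc (Suc k)) j"
proof (induction j rule: less_induct)
  case (less j)
  consider "j = 0" | "j = 1" | i where "j = Suc (Suc i)"
    by (metis One_nat_def not0_implies_Suc)
  then show ?case
  proof cases
    case 3
    have "continuant R k (Suc (Suc (Suc (Suc i)))) =
        continuant R k (Suc (Suc (Suc i))) + R (Suc (k + Suc (Suc i))) * continuant R k (Suc (Suc i))"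
      by (rule continuant.simps)
    also have "\<dots> = continuant R (Suc k) (Suc (Suc i)) + R (Suc k) * continuant R (Suc (Suc k)) (Suc i)
        + R (Suc (k + Suc (Suc i))) * (continuant R (Suc k) (Suc i) + R (Suc k) * continuant R (Suc (Suc k)) i)"
      using less[of "Suc i"] less[of i] 3 by (simp only: lessI less_SucI)
    finally show ?thesis by (simp add: 3 algebra_simps)
  qed (auto simp: algebra_simps)
qed

text \<open>The continuants satisfy the recurrence adjoint to that of f, so this bilinear expression
  does not change with j; at j = 0 it is the recurrence for f k.\<close>

lemma continuant_invariant:
  assumes "\<And>n. f n = f (Suc n) + R (Suc n) * f (Suc (Suc n))"
  shows "continuant R k (Suc j) * f (Suc (k + j)) + R (Suc (k + j)) * continuant R k j * f (Suc (Suc (k + j)))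
         = f k"
proof (induction j)
  case 0
  then show ?case using assms[of k] by simp
next
  case (Suc j)
  have "f (Suc (k + j)) = f (Suc (Suc (k + j))) + R (Suc (Suc (k + j))) * f (Suc (Suc (Suc (k + j))))"
    by (rule assms)
  with Suc show ?case by (simp add: algebra_simps)
qed

text \<open>Expanding the continuant at the front and f k by its recurrence turns the difference at
  k into - R (k + 1) times the difference at k + 1 with j lowered by one. Hence k is kept arbitrary
  in the induction.\<close>

lemma continuant_casoratian:
  assumes "\<And>n. f n = f (Suc n) + R (Suc n) * f (Suc (Suc n))"
  shows "f (Suc k) * continuant R k (Suc j) - f k * continuant R (Suc k) j
         = (\<Prod>i=Suc k..Suc (k + j). - R i) * f (Suc (Suc (k + j)))"
proof (induction j arbitrary: k)
  case 0
  then show ?case using assms[of k] by simp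
next
  case (Suc j)
  have "f (Suc k) * continuant R k (Suc (Suc j)) - f k * continuant R (Suc k) (Suc j)
      = - R (Suc k) * (f (Suc (Suc k)) * continuant R (Suc k) (Suc j)
          - f (Suc k) * continuant R (Suc (Suc k)) j)"
    unfolding continuant_left by (subst (2) assms) (simp add: algebra_simps)
  also have "\<dots> = - R (Suc k) * ((\<Prod>i=Suc (Suc k)..Suc (Suc k + j). - R i) * f (Suc (Suc (Suc k + j))))"
    by (simp only: Suc)
  also have "\<dots> = (\<Prod>i=Suc k..Suc (k + Suc j). - R i) * f (Suc (Suc (k + Suc j)))"
    by (subst (2) prod.atLeast_Suc_atMost) auto
  finally show ?case .
qed

text \<open>Each inner value is a quotient of neighbouring continuants, and adding 1 to it is
  exactly the front expansion. The continuants with \<open>k < i\<close> are the inner denominators,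
  by which the evaluation really divides.\<close>

lemma foldr_cf_eq_continuant:
  assumes "\<And>i. k < i \<Longrightarrow> i \<le> n \<Longrightarrow> continuant R i (Suc n - i) \<noteq> 0" and "k \<le> n"
  shows "foldr (\<lambda>i t. R i / (1 + t)) [k..<Suc n] 0
         = R k * continuant R (Suc k) (n - k) / continuant R k (Suc n - k)"
  using assms(2,1)
proof (induction k rule: inc_induct)
  case base
  then show ?case by simp
next
  case (step k)
  define t where "t = foldr (\<lambda>i t. R i / (1 + t)) [Suc k..<Suc n] 0"
  obtain j where j: "n = Suc (k + j)" using step(2) less_imp_Suc_add by blast
  have t: "t = R (Suc k) * continuant R (Suc (Suc k)) j / continuant R (Suc k) (Suc j)"
    using step.IH step.prems by (simp add: t_def j Suc_diff_le)
  have nz: "continuant R (Suc k) (Suc j) \<noteq> 0"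
    using step.prems[of "Suc k"] by (simp add: j)
  have "[k..<Suc n] = k # [Suc k..<Suc n]" using step(2) by (simp add: upt_conv_Cons)
  then have "foldr (\<lambda>i t. R i / (1 + t)) [k..<Suc n] 0 = R k / (1 + t)"
    by (simp only: foldr_Cons t_def o_apply)
  also have "1 + t = continuant R k (Suc (Suc j)) / continuant R (Suc k) (Suc j)"
    unfolding t continuant_left using nz by (simp add: field_simps)
  finally show ?case by (simp add: j Suc_diff_le del: continuant.simps)
qed

corollary finite_cf_eq_continuant:
  assumes "\<And>i. 0 < i \<Longrightarrow> i \<le> n \<Longrightarrow> continuant R i (Suc n - i) \<noteq> 0"
  shows "finite_cf R n = R 0 * continuant R 1 n / continuant R 0 (Suc n)"
  using foldr_cf_eq_continuant[of 0 n R] assms by (simp add: finite_cf_def del: continuant.simps upt_Suc)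

text \<open>All that the error analysis has to know about hypergeometric functions. The limit r of R
  fits the growth of f: dividing the recurrence by f n and passing to the limit gives 1 = (1 + w) +
  r (1 + w)^2.\<close>

locale convergent_cf =
  fixes R f :: "nat \<Rightarrow> complex" and w :: real and D :: complex
  assumes recurrence: "f n = f (Suc n) + R (Suc n) * f (Suc (Suc n))"
    and R_0: "R 0 = 1"
    and R_nz: "n > 0 \<Longrightarrow> R n \<noteq> 0"
    and w_abs: "\<bar>w\<bar> < 1"
    and R_lim: "half_rate R (- of_real w / (1 + of_real w)\<^sup>2)"
    and f_lim: "half_rate (\<lambda>n. f n / (1 + of_real w) ^ n) D"
    and D_nz: "D \<noteq> 0"
begin

lemma w_nz: "1 + complex_of_real w \<noteq> 0" "1 - complex_of_real w \<noteq> 0"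
  using w_abs by (auto simp: complex_eq_iff abs_if split: if_splits)

lemma f_nz: "\<forall>\<^sub>F n in sequentially. f n \<noteq> 0"
  using tendsto_imp_eventually_ne[OF half_rate_tendsto[OF f_lim] D_nz]
  by eventually_elim auto

lemma f_ratio: "half_rate (\<lambda>n. f (n + k) / f n) ((1 + of_real w) ^ k)"
proof -
  have "half_rate (\<lambda>n. (1 + of_real w) ^ k * (f (n + k) / (1 + of_real w) ^ (n + k) / (f n / (1 + of_real w) ^ n)))
     ((1 + of_real w) ^ k * (D / D))"
    by (intro half_rate_mult half_rate_divide half_rate_const half_rate_offset[OF f_lim] f_lim D_nz)
  then show ?thesis
    using D_nz w_nz by (simp add: power_add mult_ac)
qed

text \<open>The coefficient in the first-order recursion for the normalised continuants. Where f n
  is nonzero it equals 1 - f (n + 1) / f n.\<close>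

definition \<rho> :: "nat \<Rightarrow> complex" where
  "\<rho> n = R (Suc n) * f (Suc (Suc n)) / f n"

lemma \<rho>_lim: "half_rate \<rho> (- of_real w)"
proof -
  have "half_rate (\<lambda>n. R (n + 1) * (f (n + 2) / f n))
      (- of_real w / (1 + of_real w)\<^sup>2 * (1 + of_real w)\<^sup>2)"
    by (intro half_rate_mult half_rate_offset[OF R_lim] f_ratio)
  then show ?thesis
    unfolding \<rho>_def[abs_def] using w_nz by simp
qed

text \<open>Multiplying the continuants by the known solution f reduces their second-order
  recurrence to an affine recursion of first order, which is the invariant divided by f at the index
  in between.\<close>

lemma scaled_continuant_step:
  assumes "f (Suc (k + j)) \<noteq> 0"
  shows "continuant R k (Suc (Suc j)) * f (Suc (Suc (k + j))) =
         f k - \<rho> (Suc (k + j)) * (continuant R k (Suc j) * f (Suc (k + j)))"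
  using continuant_invariant[of f R k "Suc j", OF recurrence] assms
  by (simp add: \<rho>_def algebra_simps del: continuant.simps)

lemma scaled_continuant_lim:
  "half_rate (\<lambda>j. continuant R k (Suc j) * f (Suc (k + j))) (f k / (1 - of_real w))"
proof -
  have "\<forall>\<^sub>F j in sequentially. f (j + Suc k) \<noteq> 0"
    using f_nz by (rule eventually_compose_filterlim) (rule filterlim_add_const_nat_at_top)
  then have "\<forall>\<^sub>F j in sequentially. continuant R k (Suc (Suc j)) * f (Suc (k + Suc j)) =
     f k - \<rho> (j + Suc k) * (continuant R k (Suc j) * f (Suc (k + j)))"
    by eventually_elim (use scaled_continuant_step[of k] in \<open>simp add: add_ac del: continuant.simps\<close>)
  from half_rate_affine_recursion[OF this half_rate_offset[OF \<rho>_lim]]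
  show ?thesis using w_abs by simp
qed

text \<open>Since \<open>x / 0 = 0\<close>, a vanishing inner denominator would spoil the value of \<open>finite_cf\<close>, so all
  of them have to be excluded for large \<open>n\<close>, even those whose limit \<open>f k / f (k + 1)\<close> is zero.\<close>

lemma continuant_eventually_nz: "\<forall>\<^sub>F j in sequentially. continuant R k j \<noteq> 0"
proof (cases "f k = 0")
  case False
  have "f k / (1 - of_real w) \<noteq> 0" using False w_nz by simp
  from tendsto_imp_eventually_ne[OF half_rate_tendsto[OF scaled_continuant_lim] this]
  have "\<forall>\<^sub>F j in sequentially. continuant R k (Suc j) \<noteq> 0"
    by eventually_elim auto
  then show ?thesis by (subst (asm) eventually_sequentially_Suc)
next
  case True
  obtain N where N: "\<And>n. n \<ge> N \<Longrightarrow> f n \<noteq> 0"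
    using f_nz by (auto simp: eventually_sequentially)
  \<comment> \<open>With f k = 0 the affine recursion becomes homogeneous, and its factor does not
    vanish far out; so either all late continuants vanish or none does.\<close>
  have up: "continuant R k (Suc (Suc j)) = 0 \<longleftrightarrow> continuant R k (Suc j) = 0" if "j \<ge> N" for j
    using scaled_continuant_step[of k j] N[of "Suc (k + j)"] N[of "Suc (Suc (k + j))"]
      R_nz[of "Suc (Suc (k + j))"] N[of "Suc (Suc (Suc (k + j)))"] True that
    by (auto simp: \<rho>_def simp del: continuant.simps)
  show ?thesis
  proof (cases "continuant R k (Suc N) = 0")
    case True
    then have z: "continuant R k (Suc (Suc N)) = 0" using up by blast
    \<comment> \<open>Two consecutive zeros propagate downwards because the coefficients are
      nonzero, and would reach the initial value 1.\<close>
    have "continuant R k i = 0 \<and> continuant R k (Suc i) = 0" if "i \<le> Suc N" for i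
      using that
    proof (induction i rule: inc_induct)
      case (step i)
      then show ?case using R_nz[of "Suc (k + i)"] continuant.simps(3)[of R k i] by auto
    qed (use z True in blast)
    from this[of 0] show ?thesis by simp
  next
    case False
    have "continuant R k (Suc j) \<noteq> 0" if "j \<ge> N" for j
      using that by (induction j rule: dec_induct) (use False up in blast)+
    then have "continuant R k j \<noteq> 0" if "j \<ge> Suc N" for j
      using that by (cases j) auto
    then show ?thesis by (auto simp: eventually_sequentially)
  qed
qed

text \<open>Uniformity in \<open>k\<close>: the normalised continuants start near \<open>1 + w\<close> and stay in the disc of radius
  \<open>\<theta> * \<bar>c\<bar>\<close> around the fixed point \<open>c = 1 / (1 - w)\<close>, which does not contain 0.\<close>

lemma continuants_nz_far_out: "\<exists>N. \<forall>k\<ge>N. \<forall>j. continuant R k (Suc j) \<noteq> 0"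
proof -
  define c :: complex where "c = 1 / (1 - of_real w)"
  \<comment> \<open>The lower bound w^2 comes from the starting value, since 1 + w differs from c by
    - w^2 c; the upper bound 1 keeps 0 outside the disc.\<close>
  obtain \<theta> where \<theta>: "w\<^sup>2 < \<theta>" "\<theta> < 1"
    using dense[of "w\<^sup>2" 1] w_abs by (auto simp: abs_square_less_1)
  have \<theta>0: "0 < \<theta>" using \<theta>(1) zero_le_power2[of w] by linarith
  \<comment> \<open>Chosen so that 2 \<epsilon> + \<bar>w\<bar> \<theta> = \<theta>: inside the disc
    the values are at most 2 \<bar>c\<bar> in size, and one step then leads back into the
    disc.\<close>
  define \<epsilon> where "\<epsilon> = (1 - \<bar>w\<bar>) * \<theta> / 2"
  have \<epsilon>: "\<epsilon> > 0" using w_abs \<theta>0 by (simp add: \<epsilon>_def)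
  have c: "norm c > 0" "c \<noteq> 0" using w_nz by (auto simp: c_def)
  have c_fix: "c = 1 + of_real w * c" using w_nz by (simp add: c_def field_simps)
  have "\<forall>\<^sub>F n in sequentially. dist (\<rho> n) (- of_real w) < \<epsilon>"
    using tendstoD[OF half_rate_tendsto[OF \<rho>_lim] \<epsilon>] .
  moreover have "(1 + of_real w) - c = - (of_real w)\<^sup>2 * c"
    using w_nz by (simp add: c_def field_simps power2_eq_square)
  then have "norm ((1 + of_real w) - c) < \<theta> * norm c"
    using \<theta>(1) c by (simp add: norm_mult norm_power)
  then have "\<forall>\<^sub>F n in sequentially. norm (f (n + 1) / f n - c) < \<theta> * norm c"
    using half_rate_tendsto[OF f_ratio[of 1]]
    by (intro order_tendstoD(2)[of _ "norm ((1 + of_real w) - c)"] tendsto_intros) auto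
  ultimately have "\<forall>\<^sub>F n in sequentially. f n \<noteq> 0 \<and> dist (\<rho> n) (- of_real w) < \<epsilon> \<and>
      norm (f (n + 1) / f n - c) < \<theta> * norm c"
    using f_nz by eventually_elim auto
  then obtain N where N: "\<And>n. n \<ge> N \<Longrightarrow> f n \<noteq> 0" "\<And>n. n \<ge> N \<Longrightarrow> norm (\<rho> n + of_real w) < \<epsilon>"
      "\<And>n. n \<ge> N \<Longrightarrow> norm (f (n + 1) / f n - c) < \<theta> * norm c"
    by (auto simp: eventually_sequentially dist_norm)
  have "continuant R k (Suc j) \<noteq> 0" if k: "k \<ge> N" for k j
  proof -
    define v where "v j = continuant R k (Suc j) * f (Suc (k + j)) / f k" for j
    have near: "norm (v j - c) \<le> \<theta> * norm c" for j
    proof (induction j)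
      case 0
      then show ?case using N(3)[OF k] by (simp add: v_def)
    next
      case (Suc j)
      define r where "r = \<rho> (Suc (k + j))"
      have "v (Suc j) = 1 - r * v j"
        using scaled_continuant_step[of k j] N(1)[of "Suc (k + j)"] N(1)[of k] k
        by (simp add: v_def r_def diff_divide_distrib del: continuant.simps)
      then have "v (Suc j) - c = - ((r + of_real w) * v j) + of_real w * (v j - c)"
        by (subst c_fix) (simp add: algebra_simps)
      then have "norm (v (Suc j) - c) \<le> norm (r + of_real w) * norm (v j) + \<bar>w\<bar> * norm (v j - c)"
        using norm_triangle_ineq[of "- ((r + of_real w) * v j)" "of_real w * (v j - c)"]
        by (simp add: norm_mult)
      also have "norm (v j) \<le> 2 * norm c"
        using norm_triangle_ineq[of "v j - c" c] Suc
          mult_right_mono[OF less_imp_le[OF \<theta>(2)] norm_ge_zero[of c]] by simp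
      then have "norm (r + of_real w) * norm (v j) \<le> \<epsilon> * (2 * norm c)"
        using N(2)[of "Suc (k + j)"] k \<epsilon> by (intro mult_mono) (auto simp: r_def)
      then have "norm (r + of_real w) * norm (v j) + \<bar>w\<bar> * norm (v j - c)
          \<le> \<epsilon> * (2 * norm c) + \<bar>w\<bar> * (\<theta> * norm c)"
        using Suc by (intro add_mono mult_left_mono) auto
      also have "\<dots> = \<theta> * norm c" by (simp add: \<epsilon>_def field_simps)
      finally show ?case .
    qed
    have "v j \<noteq> 0"
      using near[of j] \<theta> c by (auto simp: mult_le_cancel_right)
    then show ?thesis by (auto simp: v_def simp del: continuant.simps)
  qed
  then show ?thesis by blast
qed

text \<open>The number of inner denominators grows with n, so non-vanishing for each fixed k is not
  enough. It settles the finitely many k below N, and the uniform statement settles all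
  others.\<close>

lemma finite_cf_eventually_eq:
  "\<forall>\<^sub>F n in sequentially. finite_cf R n = continuant R 1 n / continuant R 0 (Suc n)"
proof -
  obtain N where N: "\<And>k j. k \<ge> N \<Longrightarrow> continuant R k (Suc j) \<noteq> 0"
    using continuants_nz_far_out by blast
  have "\<forall>\<^sub>F n in sequentially. continuant R k (Suc n - k) \<noteq> 0" for k
  proof -
    have "filterlim (\<lambda>n. Suc n - k) at_top sequentially"
      by (intro filterlim_compose[OF filterlim_minus_const_nat_at_top] filterlim_Suc)
    then show ?thesis
      by (rule eventually_compose_filterlim[OF continuant_eventually_nz])
  qed
  then have "\<forall>\<^sub>F n in sequentially. \<forall>k\<in>{..<N}. continuant R k (Suc n - k) \<noteq> 0"
    by (intro eventually_ball_finite) auto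
  then show ?thesis
  proof eventually_elim
    case (elim n)
    have "continuant R k (Suc n - k) \<noteq> 0" if "k \<le> n" for k
    proof (cases "k < N")
      case False
      then show ?thesis using N[of k "n - k"] that by (simp add: Suc_diff_le)
    qed (use elim in auto)
    then show ?case using finite_cf_eq_continuant[of n R] R_0 by simp
  qed
qed

text \<open>Writing the last continuant as x n / f (n + 1) in the Casoratian formula leaves f (n +
  1) f (n + 2) in the numerator; this accounts for the square of D and for the exponent 2 n + 3. The
  factor 1 - w comes from the limit f 0 / (1 - w) of x.\<close>

theorem error_asymptotics:
  assumes f0: "f 0 \<noteq> 0"
  shows "half_rate (\<lambda>n. (f 1 / f 0 - finite_cf R n) /
            ((\<Prod>i=1..Suc n. - R i) * (1 + of_real w) ^ (2 * n + 3)))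
          (D\<^sup>2 * (1 - of_real w) / (f 0)\<^sup>2)"
proof -
  define W :: complex where "W = 1 + of_real w"
  have W: "W \<noteq> 0" using w_nz by (simp add: W_def)
  define x where "x n = continuant R 0 (Suc n) * f (Suc n)" for n
  have x: "half_rate x (f 0 / (1 - of_real w))"
    using scaled_continuant_lim[of 0] by (simp add: x_def[abs_def] del: continuant.simps)
  have "half_rate (\<lambda>n. (f (n + 1) / W ^ (n + 1)) * (f (n + 2) / W ^ (n + 2)) / (f 0 * x n))
      (D * D / (f 0 * (f 0 / (1 - of_real w))))"
    using f0 w_nz unfolding W_def
    by (intro half_rate_mult half_rate_divide half_rate_const half_rate_offset[OF f_lim] x) auto
  moreover have "\<forall>\<^sub>F n in sequentially. (f 1 / f 0 - finite_cf R n) /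
            ((\<Prod>i=1..Suc n. - R i) * W ^ (2 * n + 3))
      = (f (n + 1) / W ^ (n + 1)) * (f (n + 2) / W ^ (n + 2)) / (f 0 * x n)"
  proof -
    have "\<forall>\<^sub>F n in sequentially. f (Suc n) \<noteq> 0"
      using f_nz eventually_sequentially_Suc[of "\<lambda>n. f n \<noteq> 0"] by blast
    moreover have "\<forall>\<^sub>F n in sequentially. continuant R 0 (Suc n) \<noteq> 0"

      using continuant_eventually_nz[of 0] eventually_sequentially_Suc[of "\<lambda>n. continuant R 0 n \<noteq> 0"]
      by blast
    ultimately show ?thesis
      using finite_cf_eventually_eq
    proof eventually_elim
      case (elim n)
      define P where "P = (\<Prod>i=1..Suc n. - R i)"
      have P: "P \<noteq> 0" using R_nz by (auto simp: P_def)
      have "f 1 / f 0 - finite_cf R n = P * f (n + 2) / (f 0 * continuant R 0 (Suc n))"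
        using continuant_casoratian[of f R 0 n, OF recurrence] f0 elim
        by (simp add: P_def field_simps del: continuant.simps prod.cl_ivl_Suc)
      moreover have "2 * n + 3 = (n + 1) + (n + 2)" by simp
      then have "W ^ (2 * n + 3) = W ^ (n + 1) * W ^ (n + 2)" by (simp only: power_add)
      ultimately show ?case
        unfolding P_def[symmetric] x_def using P W f0 elim by (simp del: continuant.simps)
    qed
  qed
  moreover have "D * D / (f 0 * (f 0 / (1 - of_real w))) = D\<^sup>2 * (1 - of_real w) / (f 0)\<^sup>2"
    by (simp add: power2_eq_square)
  ultimately show ?thesis
    unfolding W_def using half_rate_cong by simp
qed

end

section \<open>The product of the coefficients of Gauss's continued fraction\<close>

lemma norm_exp_minus_linear_le:
  assumes "norm (w :: complex) \<le> 1"
  shows "norm (exp w - 1 - w) \<le> 3 * (norm w)\<^sup>2"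
proof -
  have "\<bar>Re w\<bar> \<le> 1" using abs_Re_le_cmod[of w] assms by linarith
  then have "exp \<bar>Re w\<bar> \<le> exp 1" by simp
  then have "exp \<bar>Re w\<bar> \<le> 3" using exp_le by linarith
  then have "exp \<bar>Re w\<bar> * (norm w)\<^sup>2 \<le> 3 * (norm w)\<^sup>2"
    by (rule mult_right_mono) simp
  moreover have "norm (exp w - 1 - w) \<le> exp \<bar>Re w\<bar> * (norm w)\<^sup>2"
    using Taylor_exp[of w 1] by (simp add: power2_eq_square diff_diff_eq)
  ultimately show ?thesis by linarith
qed

lemma rGamma_series_Suc_ratio:
  assumes "n > 0"
  shows "rGamma_series z (Suc n) =
     rGamma_series z n * ((1 + z / of_nat (Suc n)) * exp (- z * of_real (ln (1 + 1 / n))))"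
proof -
  have "ln (1 + 1 / real n) = ln (real (Suc n)) - ln (real n)"
  proof -
    have "1 + 1 / real n = real (Suc n) / real n" using assms by (simp add: field_simps)
    then show ?thesis using assms by (simp add: ln_div del: of_nat_Suc)
  qed
  then have "exp (- z * of_real (ln (1 + 1 / n)))
      = exp (z * of_real (ln (real n))) / exp (z * of_real (ln (real (Suc n))))"
    by (simp only: exp_diff[symmetric]) (simp add: algebra_simps del: of_nat_Suc)
  moreover have "1 + z / of_nat (Suc n) = (z + of_nat (Suc n)) / of_nat (Suc n)"
    by (simp add: field_simps del: of_nat_Suc)
  ultimately show ?thesis
    unfolding rGamma_series_def
    by (simp add: pochhammer_Suc[of z "Suc n"] fact_Suc[of n] del: of_nat_Suc fact_Suc)
qed

text \<open>The quotient of successive terms is 1 + q n, where z / (n + 1) and z ln (1 + 1 / n)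
  cancel to first order, so that q n = O(1 / n^2). As the terms are bounded, their increments are
  small enough for a rate.\<close>

lemma half_rate_rGamma_series: "half_rate (rGamma_series z) (rGamma z)"
proof (rule half_rate_of_small_increments[OF rGamma_series_LIMSEQ])
  define d where "d n = ln (1 + 1 / real n)" for n
  define q where "q n = (1 + z / of_nat (Suc n)) * exp (- z * of_real (d n)) - 1" for n
  have d: "d \<in> O(\<lambda>n. 1 / real n)" unfolding d_def by real_asymp
  have "(\<lambda>n. norm (- z * complex_of_real (d n))) \<longlonglongrightarrow> norm (- z * complex_of_real 0)"
    unfolding d_def by (intro tendsto_intros) real_asymp
  then have small: "\<forall>\<^sub>F n in sequentially. norm (- z * complex_of_real (d n)) < 1"
    by (rule order_tendstoD) simp
  define \<delta> where "\<delta> n = exp (- z * of_real (d n)) - 1 - (- z * of_real (d n))" for n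
  have \<delta>: "(\<lambda>n. norm (\<delta> n)) \<in> O(\<lambda>n. 1 / real n ^ 2)"
  proof -
    have "(\<lambda>n. norm (\<delta> n)) \<in> O(\<lambda>n. (d n)\<^sup>2)"
    proof (rule bigoI)
      show "\<forall>\<^sub>F n in sequentially. norm (norm (\<delta> n)) \<le> (3 * (norm z)\<^sup>2) * norm ((d n)\<^sup>2)"
        using small
      proof eventually_elim
        case (elim n)
        then show ?case
          using norm_exp_minus_linear_le[of "- z * of_real (d n)"]
          by (simp add: \<delta>_def norm_mult power_mult_distrib)
      qed
    qed
    also have "(\<lambda>n. (d n)\<^sup>2) \<in> O(\<lambda>n. 1 / real n ^ 2)" unfolding d_def by real_asymp
    finally show ?thesis .
  qed
  have "norm (q n) \<le> norm z * \<bar>1 / real (Suc n) - d n\<bar> + (norm z)\<^sup>2 * \<bar>d n / real (Suc n)\<bar>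
      + (1 + norm z) * norm (\<delta> n)" for n
  proof -
    have "q n = z * of_real (1 / real (Suc n) - d n) - z\<^sup>2 * of_real (d n / real (Suc n))
        + (1 + z / of_nat (Suc n)) * \<delta> n"
      by (simp add: q_def \<delta>_def algebra_simps power2_eq_square add_divide_distrib diff_divide_distrib)
    then have "norm (q n) \<le> norm (z * of_real (1 / real (Suc n) - d n))
        + norm (z\<^sup>2 * of_real (d n / real (Suc n))) + norm ((1 + z / of_nat (Suc n)) * \<delta> n)"
      using norm_triangle_ineq norm_triangle_ineq4
      by (metis (no_types, lifting) add_right_mono order_trans)
    moreover have "norm (1 + z / of_nat (Suc n)) \<le> 1 + norm z"
    proof -
      have "norm (1 + z / of_nat (Suc n)) \<le> 1 + norm z / real (Suc n)"
        using norm_triangle_ineq[of 1 "z / of_nat (Suc n)"] by (simp add: norm_divide del: of_nat_Suc)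
      also have "norm z / real (Suc n) \<le> norm z"
        by (simp add: field_simps)
      finally show ?thesis by simp
    qed
    then have "norm ((1 + z / of_nat (Suc n)) * \<delta> n) \<le> (1 + norm z) * norm (\<delta> n)"
      by (simp add: norm_mult mult_right_mono)
    ultimately show ?thesis
      by (simp only: norm_mult norm_power norm_of_real)
  qed
  then have "(\<lambda>n. norm (q n)) \<in> O(\<lambda>n. norm z * \<bar>1 / real (Suc n) - d n\<bar> + (norm z)\<^sup>2 * \<bar>d n / real (Suc n)\<bar>
      + (1 + norm z) * norm (\<delta> n))"
    by (intro bigoI[of _ 1] always_eventually allI)
       (simp only: real_norm_def abs_norm_cancel mult_1_left, rule order.trans[OF _ abs_ge_self])
  also have "(\<lambda>n. norm z * \<bar>1 / real (Suc n) - d n\<bar> + (norm z)\<^sup>2 * \<bar>d n / real (Suc n)\<bar>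
      + (1 + norm z) * norm (\<delta> n)) \<in> O(\<lambda>n. 1 / real n ^ 2)"
  proof (intro sum_in_bigo)
    have "(\<lambda>n. 1 / real (Suc n) - d n) \<in> O(\<lambda>n. 1 / real n ^ 2)" unfolding d_def by real_asymp
    then show "(\<lambda>n. norm z * \<bar>1 / real (Suc n) - d n\<bar>) \<in> O(\<lambda>n. 1 / real n ^ 2)" by simp
    have "(\<lambda>n. d n / real (Suc n)) \<in> O(\<lambda>n. 1 / real n ^ 2)" unfolding d_def by real_asymp
    then show "(\<lambda>n. (norm z)\<^sup>2 * \<bar>d n / real (Suc n)\<bar>) \<in> O(\<lambda>n. 1 / real n ^ 2)"
      by (simp del: abs_divide of_nat_Suc)
    show "(\<lambda>n. (1 + norm z) * norm (\<delta> n)) \<in> O(\<lambda>n. 1 / real n ^ 2)" using \<delta> by simp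
  qed
  finally have q: "(\<lambda>n. norm (q n)) \<in> O(\<lambda>n. 1 / real n ^ 2)" by simp
  have "(\<lambda>n. norm (rGamma_series z n)) \<in> O(\<lambda>_. 1)"
    using tendsto_norm[OF rGamma_series_LIMSEQ, of z] by (intro bigoI_tendsto) auto
  then have "(\<lambda>n. norm (rGamma_series z n) * norm (q n)) \<in> O(\<lambda>n. 1 * (1 / real n ^ 2))"
    using q by (rule landau_o.big.mult)
  also have "(\<lambda>n. 1 * (1 / real n ^ 2)) \<in> O(\<lambda>n. real n powr (-3/2))" by real_asymp
  finally have *: "(\<lambda>n. norm (rGamma_series z n) * norm (q n)) \<in> O(\<lambda>n. real n powr (-3/2))" .
  have eq: "\<forall>\<^sub>F n in sequentially. norm (rGamma_series z n) * norm (q n)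
      = norm (rGamma_series z (Suc n) - rGamma_series z n)"
    using eventually_gt_at_top[of 0]
  proof eventually_elim
    case (elim n)
    have "rGamma_series z (Suc n) - rGamma_series z n = rGamma_series z n * q n"
      unfolding rGamma_series_Suc_ratio[OF elim] q_def d_def by (simp add: algebra_simps)
    then show ?case by (simp only: norm_mult)
  qed
  from * show "(\<lambda>n. norm (rGamma_series z (Suc n) - rGamma_series z n)) \<in> O(\<lambda>n. real n powr (-3/2))"
    unfolding landau_o.big.in_cong[OF eq] .
qed

lemma pochhammer_eq_rGamma_series:
  "pochhammer z (Suc n) = rGamma_series z n * (fact n * exp (z * of_real (ln (real n))))"
  by (simp add: rGamma_series_def)

text \<open>Taking an odd and the following even coefficient together lets every linear factor run
  through a full Pochhammer symbol.\<close>

lemma gauss_cf_coeff_prod_even: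
  "(\<Prod>i=1..2 * m. - gauss_cf_coeff a b c z i) =
     z ^ (2 * m) * (pochhammer b m * pochhammer (c - a) m * pochhammer (a + 1) m * pochhammer (c - b + 1) m)
       / (pochhammer c (2 * m) * pochhammer (c + 1) (2 * m))"
proof (induction m)
  case (Suc m)
  have "(\<Prod>i=1..2 * Suc m. - gauss_cf_coeff a b c z i) =
      (\<Prod>i=1..2 * m. - gauss_cf_coeff a b c z i) *
        ((- gauss_cf_coeff a b c z (2 * m + 1)) * (- gauss_cf_coeff a b c z (2 * m + 2)))"
    by (simp add: mult.assoc del: gauss_cf_coeff.simps)
  also have "\<dots> = z ^ (2 * Suc m) * (pochhammer b (Suc m) * pochhammer (c - a) (Suc m)
        * pochhammer (a + 1) (Suc m) * pochhammer (c - b + 1) (Suc m))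
       / (pochhammer c (2 * Suc m) * pochhammer (c + 1) (2 * Suc m))"
  proof -
    have e: "of_nat m + c - a = c - a + of_nat m" "of_nat m + b = b + of_nat m"
      "of_nat m + a + 1 = a + 1 + of_nat m" "of_nat m + c - b + 1 = c - b + 1 + of_nat m"
      by simp_all
    have p2: "pochhammer x (2 * Suc m) = pochhammer x (2 * m) * ((x + 2 * of_nat m) * (x + 2 * of_nat m + 1))"
      for x :: complex
      by (simp add: pochhammer_Suc algebra_simps)
    have d: "2 * of_nat m + c = c + 2 * of_nat m" "2 * of_nat m + c + 1 = c + 2 * of_nat m + 1"
       "2 * of_nat m + c + 2 = c + 1 + 2 * of_nat m + 1" "c + 1 + 2 * of_nat m = c + 2 * of_nat m + 1"
       "c + 2 * of_nat m + 1 + 1 = c + 2 * of_nat m + 2"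
      by simp_all
    have z2: "z ^ (2 * Suc m) = z ^ (2 * m) * (z * z)" by simp
    show ?thesis
      unfolding Suc gauss_cf_coeff_odd gauss_cf_coeff_even e p2 d z2 pochhammer_Suc
        minus_divide_left[symmetric] minus_minus
      by (simp only: times_divide_times_eq) (simp only: mult_ac d)
  qed
  finally show ?case .
qed simp

lemma gauss_cf_coeff_half_rate:
  "half_rate (gauss_cf_coeff a b c z) (- z / 4)"
proof (rule half_rate_parity)
  have inv: "half_rate (\<lambda>m. x / of_nat m) 0" for x :: complex
    unfolding half_rate_def
  proof -
    have "(\<lambda>m. norm x * (1 / real m)) \<in> O(\<lambda>m. real m powr (-1/2))" by real_asymp
    then show "(\<lambda>m. norm (x / of_nat m - 0)) \<in> O(\<lambda>m. real m powr (-1/2))"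
      by (simp add: norm_divide)
  qed
  have A: "half_rate (\<lambda>m. 1 + x / of_nat m) 1" for x :: complex
    using half_rate_add[OF half_rate_const[of 1] inv[of x]] by simp
  have B: "half_rate (\<lambda>m. 2 + x / of_nat m) 2" for x :: complex
    using half_rate_add[OF half_rate_const[of 2] inv[of x]] by simp
  have C: "half_rate (\<lambda>m. - ((1 + p / of_nat m) * (1 + q / of_nat m) * z)
      / ((2 + r / of_nat m) * (2 + s / of_nat m))) (- (1 * 1 * z) / (2 * 2))" for p q r s
    unfolding minus_mult_right
    by (intro half_rate_divide half_rate_mult half_rate_const A B) auto
  have D: "half_rate (\<lambda>m. - ((of_nat m + p) * (of_nat m + q) * z)
      / ((2 * of_nat m + r) * (2 * of_nat m + s))) (- z / 4)" for p q r s
  proof (subst half_rate_cong[OF _ refl])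
    show "\<forall>\<^sub>F m in sequentially. - ((of_nat m + p) * (of_nat m + q) * z)
      / ((2 * of_nat m + r) * (2 * of_nat m + s)) = - ((1 + p / of_nat m) * (1 + q / of_nat m) * z)
      / ((2 + r / of_nat m) * (2 + s / of_nat m))"
      using eventually_gt_at_top[of 0]
    proof eventually_elim
      case (elim m)
      have e: "of_nat m + x = of_nat m * (1 + x / of_nat m)"
        "2 * of_nat m + x = of_nat m * (2 + x / of_nat m)" for x :: complex
        using elim by (simp_all add: field_simps)
      show ?case
        unfolding e using elim by (simp add: mult_ac)
    qed
  qed (use C[of p q r s] in simp)
  show "half_rate (\<lambda>m. gauss_cf_coeff a b c z (2 * m + 1)) (- z / 4)"
    using D[of b "c - a" c "c + 1"] unfolding gauss_cf_coeff_odd by (simp add: add_diff_eq add.assoc)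
  have "half_rate (\<lambda>m. gauss_cf_coeff a b c z (2 * m + 2)) (- z / 4)"
    using D[of "a + 1" "c - b + 1" "c + 1" "c + 2"] unfolding gauss_cf_coeff_even
    by (simp add: algebra_simps)
  \<comment> \<open>The formula for even indices starts at 2, the coefficient at 0 being 1; hence
    the shift by one.\<close>
  then have "half_rate (\<lambda>m. gauss_cf_coeff a b c z (2 * (m + 1))) (- z / 4)"
    by (simp add: algebra_simps del: gauss_cf_coeff.simps)
  then show "half_rate (\<lambda>m. gauss_cf_coeff a b c z (2 * m)) (- z / 4)"
    by (rule half_rate_of_offset)
qed

text \<open>The Pochhammer symbols are expressed by terms of \<open>rGamma_series\<close>. The
  powers of m cancel because b + (c - a) + (a + 1) + (c - b + 1) and c/2 + (c+1)/2 + (c+1)/2 +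
  (c+2)/2 are both 2 c + 2. Halving the arguments in the denominator produces the powers of 4, and
  Legendre's duplication formula reassembles the Gamma values, leaving the factor 2 pi /
  4^c.\<close>

lemma gauss_cf_coeff_prod_half_rate:
  assumes z: "z \<noteq> 0" and c: "c \<notin> \<int>\<^sub>\<le>\<^sub>0"
  shows "half_rate (\<lambda>n. (\<Prod>i=1..n. - gauss_cf_coeff a b c z i) / (z / 4) ^ n)
     (of_real (2 * pi) / 4 powr c * (Gamma c * Gamma (c + 1)
             / (Gamma (a + 1) * Gamma b * Gamma (c - a) * Gamma (c - b + 1))))"
    (is "half_rate ?Q ?L")
proof (rule half_rate_parity)
  have half: "x / 2 \<notin> \<int>\<^sub>\<le>\<^sub>0" "(x + 1) / 2 \<notin> \<int>\<^sub>\<le>\<^sub>0" if "x \<notin> \<int>\<^sub>\<le>\<^sub>0" for x :: complex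
  proof -
    have "x \<in> \<int>\<^sub>\<le>\<^sub>0" if "x / 2 \<in> \<int>\<^sub>\<le>\<^sub>0"
    proof -
      from that obtain n where "x / 2 = - of_nat n" by (elim nonpos_Ints_cases')
      then have "x = - of_nat (2 * n)" by (simp add: field_simps)
      then show ?thesis by (simp only: minus_of_nat_in_nonpos_Ints)
    qed
    moreover have "x \<in> \<int>\<^sub>\<le>\<^sub>0" if "(x + 1) / 2 \<in> \<int>\<^sub>\<le>\<^sub>0"
    proof -
      from that obtain n where "(x + 1) / 2 = - of_nat n" by (elim nonpos_Ints_cases')
      then have "x + 1 = - of_nat (2 * n)" by (simp add: field_simps)
      then have "x = - of_nat (2 * n + 1)" by (simp add: eq_diff_eq[symmetric])
      then show ?thesis by (simp only: minus_of_nat_in_nonpos_Ints)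
    qed
    ultimately show "x / 2 \<notin> \<int>\<^sub>\<le>\<^sub>0" "(x + 1) / 2 \<notin> \<int>\<^sub>\<le>\<^sub>0"
      using that by blast+
  qed
  have c1: "c + 1 \<notin> \<int>\<^sub>\<le>\<^sub>0" using c plus_one_in_nonpos_Ints_imp by blast
  have rG: "rGamma x \<noteq> 0" if "x \<notin> \<int>\<^sub>\<le>\<^sub>0" for x :: complex
    using that by (simp add: rGamma_eq_zero_iff)
  define N where "N m = rGamma_series b m * rGamma_series (c - a) m * rGamma_series (a + 1) m
      * rGamma_series (c - b + 1) m" for m
  define M where "M m = rGamma_series (c / 2) m * rGamma_series ((c + 1) / 2) m
      * (rGamma_series ((c + 1) / 2) m * rGamma_series ((c + 1 + 1) / 2) m)" for m
  define L where "L = rGamma b * rGamma (c - a) * rGamma (a + 1) * rGamma (c - b + 1)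
     / (rGamma (c / 2) * rGamma ((c + 1) / 2) * (rGamma ((c + 1) / 2) * rGamma ((c + 1 + 1) / 2)))"
  have lim: "half_rate (\<lambda>m. N m / M m) L"
    unfolding N_def M_def L_def using half[OF c] half[OF c1]
    by (intro half_rate_divide half_rate_mult half_rate_rGamma_series no_zero_divisors rG) auto
  have dup: "Gamma (x / 2) * Gamma ((x + 1) / 2) = exp ((1 - x) * of_real (ln 2)) * of_real (sqrt pi) * Gamma x"
    if "x \<notin> \<int>\<^sub>\<le>\<^sub>0" for x :: complex
    using Gamma_legendre_duplication[of "x / 2"] half[OF that] by (simp add: add_divide_distrib)
  have L: "L = ?L"
  proof -
    have c_eq: "1 - (c + 1) = - c" by simp
    have "L = (Gamma (c / 2) * Gamma ((c + 1) / 2)) * (Gamma ((c + 1) / 2) * Gamma ((c + 1 + 1) / 2))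
        / (Gamma (a + 1) * Gamma b * Gamma (c - a) * Gamma (c - b + 1))"
      by (simp add: L_def Gamma_def field_simps)
    also have "(Gamma (c / 2) * Gamma ((c + 1) / 2)) * (Gamma ((c + 1) / 2) * Gamma ((c + 1 + 1) / 2))
        = (exp ((1 - c) * of_real (ln 2)) * exp ((- c) * of_real (ln 2))) * (of_real (sqrt pi) * of_real (sqrt pi)) * (Gamma c * Gamma (c + 1))"
      unfolding dup[OF c] dup[OF c1] by (simp only: c_eq mult_ac)
    also have "exp ((1 - c) * of_real (ln 2)) * exp ((- c) * complex_of_real (ln 2)) = 2 / 4 powr c"
    proof -
      have "ln (4::real) = 2 * ln 2" using ln_realpow[of 2 2] by simp
      then have "Ln 4 = 2 * complex_of_real (ln 2)"
        using Ln_of_real[of 4] by simp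
      moreover have "exp (complex_of_real (ln 2)) = 2" by (simp add: exp_of_real)
      ultimately show ?thesis
        by (simp add: powr_def exp_add[symmetric] exp_diff algebra_simps exp_minus divide_inverse flip: exp_minus)
    qed
    also have "complex_of_real (sqrt pi) * of_real (sqrt pi) = of_real pi"
      by (simp flip: of_real_mult)
    finally show ?thesis by simp
  qed
  \<comment> \<open>The length is 2 (m + 1) because the m-th term of \<open>rGamma_series\<close>
    contains a Pochhammer symbol with m + 1 factors.\<close>
  have even: "?Q (2 * (m + 1)) = N m / M m" if m: "m > 0" for m
  proof -
    have p2: "pochhammer x (2 * Suc m) = 4 ^ Suc m * pochhammer (x / 2) (Suc m) * pochhammer ((x + 1) / 2) (Suc m)"
      for x :: complex
      using pochhammer_double[of "x / 2" "Suc m"] by (simp add: power_mult add_divide_distrib)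
    define E where "E x = exp (x * complex_of_real (ln (real m)))" for x
    have E: "E b * E (c - a) * E (a + 1) * E (c - b + 1) =
        E (c / 2) * E ((c + 1) / 2) * (E ((c + 1) / 2) * E ((c + 1 + 1) / 2))"
      by (simp add: E_def exp_add[symmetric] algebra_simps add_divide_distrib)
    have Enz: "E x \<noteq> 0" for x by (simp add: E_def)
    define F :: complex where "F = fact m"
    have Fnz: "F \<noteq> 0" by (simp add: F_def)
    define k where "k = 2 * Suc m"
    define EE where "EE = E b * E (c - a) * E (a + 1) * E (c - b + 1)"
    have num: "pochhammer b (Suc m) * pochhammer (c - a) (Suc m) * pochhammer (a + 1) (Suc m)
        * pochhammer (c - b + 1) (Suc m) = F ^ 4 * EE * N m"
      unfolding pochhammer_eq_rGamma_series E_def[symmetric] F_def[symmetric] EE_def N_def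
        power4_eq_xxxx
      by (simp only: mult_ac)
    have "(4::complex) ^ k = 4 ^ Suc m * 4 ^ Suc m" by (simp add: k_def mult_2 power_add)
    then have den: "pochhammer c k * pochhammer (c + 1) k = 4 ^ k * F ^ 4 * EE * M m"
      unfolding k_def p2 pochhammer_eq_rGamma_series E_def[symmetric] F_def[symmetric] EE_def E M_def
        power4_eq_xxxx
      by (simp only: mult_ac)
    have "?Q k = z ^ k * (pochhammer b (Suc m) * pochhammer (c - a) (Suc m) * pochhammer (a + 1) (Suc m)
        * pochhammer (c - b + 1) (Suc m)) / (pochhammer c k * pochhammer (c + 1) k) / (z / 4) ^ k"
      by (simp only: k_def gauss_cf_coeff_prod_even)
    also have "\<dots> = z ^ k * (F ^ 4 * EE * N m) / (4 ^ k * F ^ 4 * EE * M m) / (z / 4) ^ k"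
      by (simp only: num den)
    also have "\<dots> = N m / M m"
      using z Fnz Enz by (simp add: EE_def power_divide)
    finally show ?thesis by (simp add: k_def)
  qed
  show evens: "half_rate (\<lambda>m. ?Q (2 * m)) ?L"
  proof (rule half_rate_of_offset[where k = 1])
    have "\<forall>\<^sub>F m in sequentially. ?Q (2 * (m + 1)) = N m / M m"
      using eventually_gt_at_top[of 0] by eventually_elim (rule even)
    from half_rate_cong[OF this L[symmetric]] lim
    show "half_rate (\<lambda>m. ?Q (2 * (m + 1))) ?L" by simp
  qed
  \<comment> \<open>An odd product has one more factor than an even one, and that factor divided by
    its limit tends to 1.\<close>
  have "half_rate (\<lambda>m. gauss_cf_coeff a b c z (2 * m + 1)) (- z / 4)"
    by (rule half_rate_odd[OF gauss_cf_coeff_half_rate])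
  then have "half_rate (\<lambda>m. ?Q (2 * m) * (gauss_cf_coeff a b c z (2 * m + 1) / (- z / 4))) (?L * ((- z / 4) / (- z / 4)))"
    using z by (intro half_rate_mult evens half_rate_divide half_rate_const) auto
  moreover have "?Q (2 * m) * (gauss_cf_coeff a b c z (2 * m + 1) / (- z / 4)) = ?Q (2 * m + 1)" for m
    using z by (simp add: mult_ac del: gauss_cf_coeff.simps)
  ultimately show "half_rate (\<lambda>m. ?Q (2 * m + 1)) ?L" using z by simp
qed

section \<open>Laplace's method\<close>

text \<open>Differentiability at the single point t0 suffices: near t0 the linear approximation
  gives the bound, and at distance at least \<delta> boundedness does.\<close>

lemma pointwise_lipschitz:
  fixes F :: "real \<Rightarrow> complex"
  assumes cont: "continuous_on {a..b} F" and t0: "t0 \<in> {a..b}"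
    and deriv: "(F has_vector_derivative d) (at t0 within {a..b})"
  shows "\<exists>K\<ge>0. \<forall>t\<in>{a..b}. norm (F t - F t0) \<le> K * \<bar>t - t0\<bar>"
proof -
  obtain \<delta> where \<delta>: "\<delta> > 0" and near: "\<And>t. t \<in> {a..b} \<Longrightarrow> norm (t - t0) < \<delta> \<Longrightarrow>
      norm (F t - F t0 - (t - t0) *\<^sub>R d) \<le> 1 * norm (t - t0)"
    using deriv unfolding has_vector_derivative_def has_derivative_within_alt
    by (meson zero_less_one)
  have "bounded (F ` {a..b})"
    using cont by (intro compact_imp_bounded compact_continuous_image) auto
  then obtain B where B: "\<And>t. t \<in> {a..b} \<Longrightarrow> norm (F t) \<le> B"
    unfolding bounded_iff by blast
  have B0: "B \<ge> 0" using B[OF t0] norm_ge_zero order_trans by blast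
  define K where "K = max (1 + norm d) (2 * B / \<delta>)"
  have "norm (F t - F t0) \<le> K * \<bar>t - t0\<bar>" if t: "t \<in> {a..b}" for t
  proof (cases "\<bar>t - t0\<bar> < \<delta>")
    case True
    have "norm (F t - F t0) \<le> norm (F t - F t0 - (t - t0) *\<^sub>R d) + norm ((t - t0) *\<^sub>R d)"
      using norm_triangle_ineq[of "F t - F t0 - (t - t0) *\<^sub>R d" "(t - t0) *\<^sub>R d"] by simp
    also have "\<dots> \<le> 1 * \<bar>t - t0\<bar> + \<bar>t - t0\<bar> * norm d"
      using near[OF t] True by (intro add_mono) auto
    also have "\<dots> = (1 + norm d) * \<bar>t - t0\<bar>" by (simp add: algebra_simps)
    also have "\<dots> \<le> K * \<bar>t - t0\<bar>" by (intro mult_right_mono) (auto simp: K_def)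
    finally show ?thesis .
  next
    case False
    have "norm (F t - F t0) \<le> 2 * B"
      using norm_triangle_ineq4[of "F t" "F t0"] B[OF t] B[OF t0] by linarith
    also have "\<dots> \<le> 2 * B / \<delta> * \<bar>t - t0\<bar>"
      using False \<delta> B0 mult_left_mono[of \<delta> "\<bar>t - t0\<bar>" "2 * B"] by (simp add: field_simps)
    also have "\<dots> \<le> K * \<bar>t - t0\<bar>" by (intro mult_right_mono) (auto simp: K_def)
    finally show ?thesis .
  qed
  moreover have "K \<ge> 0" by (simp add: K_def le_max_iff_disj)
  ultimately show ?thesis by blast
qed

text \<open>The common normalisation of all Laplace integrals below. Only its order of magnitude
  matters, because it cancels in the quotient of two Euler integrals.\<close>

definition wallis :: "nat \<Rightarrow> real" where
  "wallis m = integral {-1..1} (\<lambda>y. (1 - y\<^sup>2) ^ m)"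

text \<open>For 0 \<le> y \<le> 1 / (2 sqrt m) Bernoulli's inequality keeps the integrand above 1 /
  2, and this interval alone contributes enough.\<close>

lemma wallis_lower_bound:
  assumes "m > 0"
  shows "wallis m \<ge> 1 / (4 * sqrt (real m))"
proof -
  define r where "r = 1 / (2 * sqrt (real m))"
  have "sqrt (real m) \<ge> 1" using assms by simp
  then have "1 \<le> 2 * sqrt (real m)" by linarith
  then have "r \<le> 1" unfolding r_def using assms by (subst divide_le_eq_1_pos) auto
  then have r: "0 < r" "r \<le> 1" "r\<^sup>2 = 1 / (4 * real m)"
    using assms by (auto simp: r_def power_divide power_mult_distrib)
  have "integral {0..r} (\<lambda>y. 1 / 2) \<le> integral {0..r} (\<lambda>y. (1 - y\<^sup>2) ^ m)"
  proof (rule integral_le)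
    fix y assume y: "y \<in> {0..r}"
    have "y\<^sup>2 \<le> r\<^sup>2" using y by (intro power_mono) auto
    then have le: "real m * y\<^sup>2 \<le> 1 / 4" using assms by (simp add: r(3) field_simps)
    have "y\<^sup>2 \<le> 1" using \<open>y\<^sup>2 \<le> r\<^sup>2\<close> power_mono[of r 1 2] r by simp
    then have "1 + real m * (- y\<^sup>2) \<le> (1 + (- y\<^sup>2)) ^ m"
      by (intro Bernoulli_inequality) simp
    then show "1 / 2 \<le> (1 - y\<^sup>2) ^ m" using le by simp
  qed (auto intro!: integrable_continuous_interval continuous_intros)
  also have "\<dots> \<le> wallis m"
    unfolding wallis_def
  proof (rule integral_subset_le)
    show "\<forall>y\<in>{-1..1::real}. 0 \<le> (1 - y\<^sup>2) ^ m"
      by (intro ballI zero_le_power) (auto simp: abs_square_le_1)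
  qed (use r in \<open>auto intro!: integrable_continuous_interval continuous_intros\<close>)
  finally show ?thesis using r by (simp add: r_def)
qed

lemma wallis_pos:
  assumes "m > 0"
  shows "wallis m > 0"
proof -
  have "0 < 1 / (4 * sqrt (real m))" using assms by simp
  then show ?thesis using wallis_lower_bound[OF assms] by linarith
qed

text \<open>This moment bounds the error of a Lipschitz integrand. Divided by
  \<open>wallis m\<close>, which is at least of order m^(-1/2), it gives the rate m^(-1/2). On each
  half of the interval the integrand has an elementary antiderivative.\<close>

lemma wallis_first_absolute_moment:
  "((\<lambda>y. (1 - y\<^sup>2) ^ m * \<bar>y\<bar>) has_integral 1 / (real m + 1)) {-1..1::real}"
proof -
  define c where "c = - (1 / (2 * (real m + 1)))"
  define P where "P y = c * (1 - y\<^sup>2) ^ Suc m" for y :: real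
  have P: "(P has_vector_derivative (1 - y\<^sup>2) ^ m * y) (at y within A)" for y A
  proof -
    have "(P has_real_derivative c * (real (Suc m) * (1 - y\<^sup>2) ^ m * (- (2 * y)))) (at y within A)"
      unfolding P_def by (rule derivative_eq_intros refl | simp)+
    also have "c * (real (Suc m) * (1 - y\<^sup>2) ^ m * (- (2 * y))) = (- 2 * real (Suc m) * c) * ((1 - y\<^sup>2) ^ m * y)"
      by (simp only: mult_ac mult_minus_left mult_minus_right)
    also have "- 2 * real (Suc m) * c = 1" by (simp add: c_def field_simps)
    finally show ?thesis by (simp add: has_real_derivative_iff_has_vector_derivative)
  qed
  have "((\<lambda>y. (1 - y\<^sup>2) ^ m * y) has_integral (P 1 - P 0)) {0..1}"
    by (rule fundamental_theorem_of_calculus) (auto intro: P)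
  then have right: "((\<lambda>y. (1 - y\<^sup>2) ^ m * \<bar>y\<bar>) has_integral (P 1 - P 0)) {0..1}"
    by (rule has_integral_eq[rotated]) auto
  have "((\<lambda>y. (1 - y\<^sup>2) ^ m * y) has_integral (P 0 - P (-1))) {-1..0}"
    by (rule fundamental_theorem_of_calculus) (auto intro: P)
  then have "((\<lambda>y. - ((1 - y\<^sup>2) ^ m * y)) has_integral - (P 0 - P (-1))) {-1..0}"
    by (rule has_integral_neg)
  then have "((\<lambda>y. (1 - y\<^sup>2) ^ m * \<bar>y\<bar>) has_integral - (P 0 - P (-1))) {-1..0}"
    by (rule has_integral_eq[rotated]) auto
  from has_integral_combine[OF _ _ this right]
  have "((\<lambda>y. (1 - y\<^sup>2) ^ m * \<bar>y\<bar>) has_integral (- (P 0 - P (-1)) + (P 1 - P 0))) {-1..1}"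
    by simp
  moreover have "- (P 0 - P (-1)) + (P 1 - P 0) = 1 / (real m + 1)"
    by (simp add: P_def c_def field_simps)
  ultimately show ?thesis by simp
qed

locale below_one =
  fixes z :: real
  assumes z: "z < 1"
begin

definition s :: real where "s = sqrt (1 - z)"
definition t0 :: real where "t0 = 1 / (1 + s)"
text \<open>On the unit interval \<phi> has its maximum 1 / (1 + s)^2 at \<open>t0\<close>. The
  function \<open>y\<close> is the signed square root of 1 - (1 + s)^2 \<phi>, and it increases from
  -1 to 1; \<open>y'\<close> is its derivative.\<close>

definition y :: "real \<Rightarrow> real" where "y t = ((1 + s) * t - 1) / sqrt (1 - z * t)"
definition y' :: "real \<Rightarrow> real" where "y' t = (1 + s) * (1 + s - z * t) / (2 * ((1 - z * t) * sqrt (1 - z * t)))"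
definition \<phi> :: "real \<Rightarrow> real" where "\<phi> t = t * (1 - t) / (1 - z * t)"

lemma s: "s > 0" "s\<^sup>2 = 1 - z" "z = (1 - s) * (1 + s)"
  using z by (auto simp: s_def algebra_simps power2_eq_square)

lemma pos: "t \<in> {0..1} \<Longrightarrow> 1 - z * t > 0"
proof -
  assume t: "t \<in> {0..1}"
  show ?thesis
  proof (cases "z \<le> 0")
    case True
    then have "z * t \<le> 0" using t by (intro mult_nonpos_nonneg) auto
    then show ?thesis by simp
  next
    case False
    then have "z * t \<le> z * 1" using t by (intro mult_left_mono) auto
    then show ?thesis using z by simp
  qed
qed

lemma t0: "t0 \<in> {0<..<1}" "1 - t0 = s * t0" "1 - z * t0 = s"
proof -
  show "t0 \<in> {0<..<1}" using s(1) by (simp add: t0_def)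
  show "1 - t0 = s * t0" using s(1) by (simp add: t0_def field_simps)
  have "z * t0 = 1 - s" using s(1) by (subst s(3)) (simp add: t0_def field_simps)
  then show "1 - z * t0 = s" by simp
qed

lemma y_ends: "y 0 = -1" "y 1 = 1"
  using s(1) by (auto simp: y_def s_def)

lemma one_minus_y_squared:
  assumes "t \<in> {0..1}"
  shows "1 - (y t)\<^sup>2 = (1 + s)\<^sup>2 * \<phi> t"
proof -
  have "(y t)\<^sup>2 = ((1 + s) * t - 1)\<^sup>2 / (1 - z * t)"
    using pos[OF assms] by (simp add: y_def power_divide)
  then have "1 - (y t)\<^sup>2 = ((1 - z * t) - ((1 + s) * t - 1)\<^sup>2) / (1 - z * t)"
    using pos[OF assms] by (simp add: field_simps)
  also have "(1 - z * t) - ((1 + s) * t - 1)\<^sup>2 = (1 + s)\<^sup>2 * (t * (1 - t))"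
    by (subst s(3)) (simp add: power2_eq_square algebra_simps)
  finally show ?thesis by (simp add: \<phi>_def)
qed

lemma y_bounds: "t \<in> {0..1} \<Longrightarrow> y t \<in> {-1..1}"
proof -
  assume t: "t \<in> {0..1}"
  have "0 \<le> (1 + s)\<^sup>2 * \<phi> t" using pos[OF t] t by (auto simp: \<phi>_def)
  then have "(y t)\<^sup>2 \<le> 1" using one_minus_y_squared[OF t] by simp
  then show ?thesis by (auto simp: abs_square_le_1)
qed

lemma y_deriv:
  assumes "t \<in> {0..1}"
  shows "(y has_real_derivative y' t) (at t within A)"
proof -
  define r where "r = sqrt (1 - z * t)"
  have r: "r > 0" "r * r = 1 - z * t" using pos[OF assms] by (auto simp: r_def)
  have "(y has_real_derivative ((1 + s) * r - ((1 + s) * t - 1) * (- z / (2 * r))) / (r * r)) (at t within A)"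
    unfolding y_def r_def using pos[OF assms]
    by (auto intro!: derivative_eq_intros simp: field_simps)
  also have "((1 + s) * r - ((1 + s) * t - 1) * (- z / (2 * r))) / (r * r)
      = (2 * (1 + s) * (r * r) + z * ((1 + s) * t - 1)) / (2 * ((r * r) * r))"
    using r(1) by (simp add: field_simps)
  also have "2 * (1 + s) * (r * r) + z * ((1 + s) * t - 1) = (1 + s) * (1 + s - z * t)"
    unfolding r(2) using s(2) by algebra
  finally show ?thesis by (simp only: y'_def r(2)) (simp only: r_def)
qed

lemma y'_pos: "t \<in> {0..1} \<Longrightarrow> y' t > 0"
  using pos[of t] s(1) by (auto simp: y'_def intro!: divide_pos_pos mult_pos_pos)

lemma y'_t0: "y' t0 = (1 + s) / sqrt s"
proof -
  have "1 + s - z * t0 = 2 * s" using t0(3) by simp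
  then have "y' t0 = (1 + s) * (2 * s) / (2 * (s * sqrt s))" by (simp only: y'_def t0(3))
  then show ?thesis using s(1) by simp
qed

text \<open>Converts a Lipschitz bound in t - t0 into one in y, the variable whose first absolute
  moment is explicit. The two differ by the bounded factor sqrt (1 - z t) / (1 + s).\<close>

lemma abs_y_ge:
  assumes "t \<in> {0..1}"
  shows "\<bar>t - t0\<bar> \<le> sqrt (1 + \<bar>z\<bar>) / (1 + s) * \<bar>y t\<bar>"
proof -
  have "1 - z * t \<le> 1 + \<bar>z\<bar>"
  proof -
    have "\<bar>z * t\<bar> \<le> \<bar>z\<bar> * 1"
      unfolding abs_mult using assms by (intro mult_left_mono) auto
    then show ?thesis by linarith
  qed
  then have le: "sqrt (1 - z * t) \<le> sqrt (1 + \<bar>z\<bar>)" by simp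
  have "(1 + s) * \<bar>t - t0\<bar> = \<bar>(1 + s) * t - 1\<bar>"
    using s(1) by (simp add: t0_def abs_mult_pos[symmetric] field_simps abs_mult)
  also have "\<dots> = sqrt (1 - z * t) * \<bar>y t\<bar>"
    using pos[OF assms] by (simp add: y_def)
  also have "\<dots> \<le> sqrt (1 + \<bar>z\<bar>) * \<bar>y t\<bar>"
    using le by (rule mult_right_mono) simp
  finally show ?thesis using s(1) by (simp add: field_simps)
qed

text \<open>The substitution \<open>y\<close> turns the weight \<open>\<phi> t ^ m\<close> into \<open>(1 - y\<^sup>2) ^ m\<close>, whatever \<open>z\<close> is;
  only the value of the remaining factor at the saddle point \<open>t0\<close> (where \<open>y = 0\<close>) survives.\<close>

lemma laplace_method:
  fixes g :: "real \<Rightarrow> complex"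
  assumes cont: "continuous_on {0..1} g" and deriv: "(g has_vector_derivative d) (at t0)"
  shows "half_rate (\<lambda>m. integral {0..1} (\<lambda>t. of_real (((1 + s)\<^sup>2 * \<phi> t) ^ m) * g t) / of_real (wallis m))
           (g t0 / of_real (y' t0))"
proof -
  \<comment> \<open>The integrand left over in the variable y, that is, g divided by the Jacobian of
    the substitution.\<close>
  define h where "h t = g t / of_real (y' t)" for t
  have cont_y': "continuous_on {0..1} y'"
    using pos unfolding y'_def by (auto intro!: continuous_intros simp: less_imp_neq[symmetric])
  have cont_y: "continuous_on {0..1} y"
    using pos unfolding y_def by (auto intro!: continuous_intros simp: less_imp_neq[symmetric])
  have y'_nz: "t \<in> {0..1} \<Longrightarrow> y' t \<noteq> 0" for t using y'_pos[of t] by auto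
  have cont_h: "continuous_on {0..1} h"
    unfolding h_def using y'_nz by (intro continuous_intros cont cont_y') auto
  have t0_in: "t0 \<in> {0..1}" using t0(1) by auto
  have "\<exists>dy. (y' has_real_derivative dy) (at t0)"
    unfolding y'_def using pos[OF t0_in]
    by (intro exI) (auto intro!: derivative_eq_intros)
  then obtain dy where dy: "(y' has_real_derivative dy) (at t0)" by blast
  have "\<exists>dh. (h has_vector_derivative dh) (at t0)"
  proof -
    have "((\<lambda>t. inverse (y' t)) has_real_derivative - (inverse (y' t0) * dy * inverse (y' t0))) (at t0)"
      using DERIV_inverse'[OF dy y'_nz[OF t0_in]] .
    from has_vector_derivative_scaleR[OF this deriv]
    have "((\<lambda>t. inverse (y' t) *\<^sub>R g t) has_vector_derivative
       (inverse (y' t0) *\<^sub>R d + (- (inverse (y' t0) * dy * inverse (y' t0))) *\<^sub>R g t0)) (at t0)" .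
    then show ?thesis unfolding h_def by (auto simp: scaleR_conv_of_real divide_inverse mult.commute)
  qed
  then obtain dh where "(h has_vector_derivative dh) (at t0)" by blast
  then have dh: "(h has_vector_derivative dh) (at t0 within {0..1})"
    by (rule has_vector_derivative_at_within)
  obtain K where K: "K \<ge> 0" "\<And>t. t \<in> {0..1} \<Longrightarrow> norm (h t - h t0) \<le> K * \<bar>t - t0\<bar>"
    using pointwise_lipschitz[OF cont_h t0_in dh] by blast
  define C where "C = K * (sqrt (1 + \<bar>z\<bar>) / (1 + s))"
  have C: "norm (h t - h t0) \<le> C * \<bar>y t\<bar>" if "t \<in> {0..1}" for t
  proof -
    have "K * \<bar>t - t0\<bar> \<le> K * (sqrt (1 + \<bar>z\<bar>) / (1 + s) * \<bar>y t\<bar>)"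
      using abs_y_ge[OF that] K(1) by (rule mult_left_mono)
    then show ?thesis using K(2)[OF that] by (simp add: C_def mult.assoc)
  qed
  have subst: "((\<lambda>t. y' t *\<^sub>R f (y t)) has_integral integral {-1..1} f) {0..1}"
    if "continuous_on {-1..1} f" for f :: "real \<Rightarrow> real"
  proof -
    have "y ` {0..1} \<subseteq> {-1..1}" using y_bounds by blast
    from has_integral_substitution[OF _ _ this that y_deriv] show ?thesis
      unfolding y_ends by simp
  qed
  have bound: "norm (integral {0..1} (\<lambda>t. of_real (((1 + s)\<^sup>2 * \<phi> t) ^ m) * g t) / of_real (wallis m) - h t0)
      \<le> (4 * C) * (sqrt (real m) / (real m + 1))" if m: "m > 0" for m
  proof -
    define I where "I = integral {0..1} (\<lambda>t. of_real (((1 + s)\<^sup>2 * \<phi> t) ^ m) * g t)"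
    have W: "((\<lambda>t. y' t *\<^sub>R (1 - (y t)\<^sup>2) ^ m) has_integral wallis m) {0..1}"
      unfolding wallis_def by (intro subst continuous_intros)
    have "((\<lambda>t. of_real (y' t *\<^sub>R (1 - (y t)\<^sup>2) ^ m) * h t0) has_integral of_real (wallis m) * h t0) {0..1}"
      by (intro has_integral_mult_left has_integral_of_real W)
    moreover have "((\<lambda>t. of_real ((1 - (y t)\<^sup>2) ^ m) * g t) has_integral I) {0..1}"
    proof -
      have "((\<lambda>t. of_real ((1 - (y t)\<^sup>2) ^ m) * g t) has_integral
          integral {0..1} (\<lambda>t. of_real ((1 - (y t)\<^sup>2) ^ m) * g t)) {0..1}"
        by (intro integrable_integral integrable_continuous_interval continuous_intros cont cont_y)
      also have "integral {0..1} (\<lambda>t. of_real ((1 - (y t)\<^sup>2) ^ m) * g t) = I"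
        unfolding I_def by (rule integral_cong) (simp add: one_minus_y_squared)
      finally show ?thesis .
    qed
    ultimately have D: "((\<lambda>t. of_real ((1 - (y t)\<^sup>2) ^ m) * g t - of_real (y' t *\<^sub>R (1 - (y t)\<^sup>2) ^ m) * h t0)
        has_integral (I - of_real (wallis m) * h t0)) {0..1}"
      by (rule has_integral_diff[rotated])
    have M: "((\<lambda>t. y' t *\<^sub>R ((1 - (y t)\<^sup>2) ^ m * \<bar>y t\<bar>)) has_integral 1 / (real m + 1)) {0..1}"
      using subst[of "\<lambda>y. (1 - y\<^sup>2) ^ m * \<bar>y\<bar>"] integral_unique[OF wallis_first_absolute_moment[of m]]
      by (simp add: continuous_intros)
    \<comment> \<open>Freezing h at the saddle point changes it by at most C \<bar>y\<bar>, so the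
      error is at most C times the first absolute moment.\<close>
    have "norm (I - of_real (wallis m) * h t0) \<le> C * (1 / (real m + 1))"
    proof -
      \<comment> \<open>The inner product with 1 presents the real dominating integral as a
        component, the form in which the domination rule is stated.\<close>
      have "norm (I - of_real (wallis m) * h t0) \<le> (C * (1 / (real m + 1))) \<bullet> 1"
      proof (rule has_integral_norm_bound_integral_component[OF D has_integral_mult_right[OF M, of C]])
        fix t :: real assume t: "t \<in> {0..1}"
        have "0 \<le> 1 - (y t)\<^sup>2" using y_bounds[OF t] by (auto simp: abs_square_le_1)
        then have "0 \<le> (1 - (y t)\<^sup>2) ^ m * y' t"
          using y'_pos[OF t] by simp
        moreover have "of_real ((1 - (y t)\<^sup>2) ^ m) * g t - of_real (y' t *\<^sub>R (1 - (y t)\<^sup>2) ^ m) * h t0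
            = of_real ((1 - (y t)\<^sup>2) ^ m * y' t) * (h t - h t0)"
          using y'_nz[OF t] by (simp add: h_def algebra_simps)
        ultimately have "norm (of_real ((1 - (y t)\<^sup>2) ^ m) * g t - of_real (y' t *\<^sub>R (1 - (y t)\<^sup>2) ^ m) * h t0)
            = (1 - (y t)\<^sup>2) ^ m * y' t * norm (h t - h t0)"
          by (simp only: norm_mult norm_of_real abs_of_nonneg)
        also have "\<dots> \<le> (1 - (y t)\<^sup>2) ^ m * y' t * (C * \<bar>y t\<bar>)"
          using C[OF t] \<open>0 \<le> (1 - (y t)\<^sup>2) ^ m * y' t\<close> by (rule mult_left_mono)
        finally show "norm (of_real ((1 - (y t)\<^sup>2) ^ m) * g t - of_real (y' t *\<^sub>R (1 - (y t)\<^sup>2) ^ m) * h t0)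
            \<le> (C * (y' t *\<^sub>R ((1 - (y t)\<^sup>2) ^ m * \<bar>y t\<bar>))) \<bullet> 1"
          by (simp add: mult_ac)
      qed
      then show ?thesis by simp
    qed
    then have "norm (I - of_real (wallis m) * h t0) / wallis m \<le> C * (1 / (real m + 1)) / (1 / (4 * sqrt (real m)))"
      using wallis_lower_bound[OF m] m K s(1) by (intro frac_le) (auto simp: C_def)
    also have "\<dots> = (4 * C) * (sqrt (real m) / (real m + 1))" by simp
    also have "norm (I - of_real (wallis m) * h t0) / wallis m = norm (I / of_real (wallis m) - h t0)"
    proof -
      have "I / of_real (wallis m) - h t0 = (I - of_real (wallis m) * h t0) / of_real (wallis m)"
        using wallis_pos[OF m] by (simp add: field_simps)
      then show ?thesis using wallis_pos[OF m] by (simp add: norm_divide)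
    qed
    finally show ?thesis by (simp add: I_def)
  qed
  have "(\<lambda>m. sqrt (real m) / (real m + 1)) \<in> O(\<lambda>m. real m powr (-1/2))" by real_asymp
  moreover have "(\<lambda>m. norm (integral {0..1} (\<lambda>t. of_real (((1 + s)\<^sup>2 * \<phi> t) ^ m) * g t) / of_real (wallis m) - h t0))
     \<in> O(\<lambda>m. sqrt (real m) / (real m + 1))"
  proof (intro bigoI[of _ "4 * C"] eventually_mono[OF eventually_gt_at_top[of 0]])
    fix m :: nat assume "m > 0"
    have "\<bar>sqrt (real m) / (real m + 1)\<bar> = sqrt (real m) / (real m + 1)" by (rule abs_of_nonneg) simp
    then show "norm (norm (integral {0..1} (\<lambda>t. of_real (((1 + s)\<^sup>2 * \<phi> t) ^ m) * g t) / of_real (wallis m) - h t0))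
        \<le> 4 * C * norm (sqrt (real m) / (real m + 1))"
      using bound[OF \<open>m > 0\<close>] by (simp only: real_norm_def abs_norm_cancel)
  qed
  ultimately show ?thesis
    unfolding half_rate_def h_def by (rule landau_o.big_trans[rotated])
qed

end

section \<open>Euler's integral and the continuation of the hypergeometric series\<close>

definition cut_plane :: "complex set" where
  "cut_plane = - (complex_of_real ` {1..})"

text \<open>\<open>hyp2f1\<close> is a Hilbert choice, about which nothing can be concluded until
  some continuation exists for the parameters at hand. The predicate makes explicit witnesses
  available, and uniqueness then identifies them with the choice.\<close>

definition has_2f1_continuation :: "complex \<Rightarrow> complex \<Rightarrow> complex \<Rightarrow> (complex \<Rightarrow> complex) \<Rightarrow> bool" where
  "has_2f1_continuation a b c f \<longleftrightarrow>
     f holomorphic_on cut_plane \<and> (\<forall>z\<in>ball 0 1. f z = hyp2f1_series a b c z)"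

text \<open>Guarantees that 1 - z t avoids the branch cut of the principal power, so that the
  integrand of Euler's integral is holomorphic in z.\<close>

lemma cut_plane_one_minus:
  assumes "z \<in> cut_plane" "t \<in> {0..1}"
  shows "1 - z * of_real t \<notin> \<real>\<^sub>\<le>\<^sub>0"
proof
  assume "1 - z * of_real t \<in> \<real>\<^sub>\<le>\<^sub>0"
  then obtain r where r: "r \<le> 0" "1 - z * of_real t = of_real r"
    by (elim nonpos_Reals_cases)
  then have zt: "z * of_real t = of_real (1 - r)" by (simp add: algebra_simps)
  then have "t \<noteq> 0" using r by auto
  then have "z = of_real ((1 - r) / t)" using zt by (simp add: field_simps)
  moreover have "(1 - r) / t \<ge> 1" using assms(2) r \<open>t \<noteq> 0\<close> by (simp add: field_simps)
  ultimately have "z \<in> complex_of_real ` {1..}" by (intro image_eqI[of _ _ "(1 - r) / t"]) auto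
  then show False using assms(1) by (auto simp: cut_plane_def)
qed

lemma open_cut_plane: "open cut_plane"
proof -
  have "cut_plane = {z. Im z \<noteq> 0} \<union> {z. Re z < 1}"
  proof (intro set_eqI iffI)
    fix z assume "z \<in> cut_plane"
    then show "z \<in> {z. Im z \<noteq> 0} \<union> {z. Re z < 1}"
      by (cases z) (auto simp: cut_plane_def image_iff complex_eq_iff not_le)
  qed (auto simp: cut_plane_def)
  moreover have "open ({z. Im z \<noteq> 0} \<union> {z. Re z < 1})"
    by (intro open_Un open_Collect_neq open_Collect_less continuous_intros)
  ultimately show ?thesis by simp
qed

lemma zero_in_cut_plane: "0 \<in> cut_plane"
  by (auto simp: cut_plane_def)

lemma of_real_in_cut_plane: "z < 1 \<Longrightarrow> of_real z \<in> cut_plane"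
  by (auto simp: cut_plane_def)

lemma ball_subset_cut_plane: "ball 0 1 \<subseteq> cut_plane"
  by (auto simp: cut_plane_def)

lemma connected_cut_plane: "connected cut_plane"
proof (rule starlike_imp_connected)
  show "starlike cut_plane"
    unfolding starlike_def
  proof (intro bexI ballI)
    fix z assume z: "z \<in> cut_plane"
    show "closed_segment 0 z \<subseteq> cut_plane"
    proof
      fix x assume "x \<in> closed_segment 0 z"
      then obtain u where u: "0 \<le> u" "u \<le> 1" "x = u *\<^sub>R z" by (auto simp: in_segment)
      show "x \<in> cut_plane"
      proof (rule ccontr)
        assume "x \<notin> cut_plane"
        then obtain r where r: "r \<ge> 1" "u *\<^sub>R z = of_real r" by (auto simp: cut_plane_def u)
        then have "1 - z * of_real u = of_real (1 - r)" by (simp add: scaleR_conv_of_real mult.commute)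
        moreover have "of_real (1 - r) \<in> \<real>\<^sub>\<le>\<^sub>0"
          using r(1) by (subst nonpos_Reals_of_real_iff) simp
        ultimately have "1 - z * of_real u \<in> \<real>\<^sub>\<le>\<^sub>0" by simp
        then show False using cut_plane_one_minus[OF z] u by auto
      qed
    qed
  qed (rule zero_in_cut_plane)
qed

lemma hyp2f1_continuation_unique:
  assumes "has_2f1_continuation a b c f" "has_2f1_continuation a b c g" "z \<in> cut_plane"
  shows "f z = g z"
  using assms open_cut_plane connected_cut_plane ball_subset_cut_plane
  unfolding has_2f1_continuation_def
  by (intro analytic_continuation_open[of "ball 0 1" cut_plane f g z]) auto

lemma has_2f1_continuation_hyp2f1:
  assumes "has_2f1_continuation a b c f"
  shows "has_2f1_continuation a b c (hyp2f1 a b c)"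
  using someI[of "\<lambda>f. has_2f1_continuation a b c f", OF assms]
  unfolding hyp2f1_def has_2f1_continuation_def cut_plane_def .

lemma hyp2f1_eqI:
  assumes "has_2f1_continuation a b c f" "z \<in> cut_plane"
  shows "hyp2f1 a b c z = f z"
  using hyp2f1_continuation_unique[OF has_2f1_continuation_hyp2f1[OF assms(1)] assms] .

lemma hyp2f1_series_commute: "hyp2f1_series a b c z = hyp2f1_series b a c z"
  by (simp add: hyp2f1_series_def mult_ac)

lemma has_2f1_continuation_commute:
  "has_2f1_continuation a b c = has_2f1_continuation b a c"
  by (simp add: fun_eq_iff has_2f1_continuation_def hyp2f1_series_commute[of a b])

lemma hyp2f1_commute: "hyp2f1 a b c = hyp2f1 b a c"
  by (simp add: hyp2f1_def hyp2f1_series_commute[of a b])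

section \<open>Gauss's contiguous relation\<close>

lemma summable_hyp2f1:
  fixes a b c z :: complex
  assumes c: "c \<notin> \<int>\<^sub>\<le>\<^sub>0" and z: "norm z < 1"
  shows "summable (\<lambda>k. pochhammer a k * pochhammer b k / (pochhammer c k * fact k) * z ^ k)"
proof -
  define u where "u k = pochhammer a k * pochhammer b k / (pochhammer c k * fact k) * z ^ k" for k
  define r where "r k = (a + of_nat k) / (c + of_nat k) * ((b + of_nat k) / (1 + of_nat k)) * z" for k
  have lim: "(\<lambda>k. (x + of_nat k) / (y + of_nat k)) \<longlonglongrightarrow> 1" for x y :: complex
  proof -
    have "(\<lambda>k. (x / of_nat k + 1) / (y / of_nat k + 1)) \<longlonglongrightarrow> (0 + 1) / (0 + 1)"
      by (intro tendsto_intros lim_const_over_n) auto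
    moreover have "\<forall>\<^sub>F k in sequentially. (x / of_nat k + 1) / (y / of_nat k + 1) = (x + of_nat k) / (y + of_nat k)"
      using eventually_gt_at_top[of 0]
    proof eventually_elim
      case (elim k)
      have "x / of_nat k + 1 = (x + of_nat k) / of_nat k" "y / of_nat k + 1 = (y + of_nat k) / of_nat k"
        using elim by (simp_all add: field_simps)
      then show ?case using elim by simp
    qed
    ultimately show ?thesis by (simp add: tendsto_cong)
  qed
  have "(\<lambda>k. norm (r k)) \<longlonglongrightarrow> norm (1 * 1 * z)"
    unfolding r_def by (rule tendsto_norm[OF tendsto_mult[OF tendsto_mult[OF lim lim] tendsto_const]])
  moreover obtain q where q: "norm z < q" "q < 1" using dense[OF z] by blast
  ultimately have "\<forall>\<^sub>F k in sequentially. norm (r k) < q"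
    by (intro order_tendstoD) auto
  then obtain N where N: "\<And>k. k \<ge> N \<Longrightarrow> norm (r k) < q"
    by (auto simp: eventually_sequentially)
  have "norm (u (Suc k)) \<le> q * norm (u k)" if "k \<ge> N" for k
  proof -
    have "u (Suc k) = r k * u k" by (simp add: u_def r_def pochhammer_Suc mult_ac)
    then show ?thesis using N[OF that] by (simp add: norm_mult mult_right_mono)
  qed
  then have "summable u" using q by (intro summable_ratio_test[of q N]) auto
  then show ?thesis unfolding u_def[abs_def] .
qed

text \<open>The constant terms agree. The factor z shifts the last series by one, so the
  coefficients of z^(k + 1) are compared; after removing the common factor G what remains is c (a +
  1 + k) - (c - a) (k + 1) = a (c + 1 + k).\<close>

lemma gauss_contiguous_series:
  assumes c: "c \<notin> \<int>\<^sub>\<le>\<^sub>0" and z: "norm z < 1"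
  shows "hyp2f1_series a b c z = hyp2f1_series (a + 1) b (c + 1) z
     - b * (c - a) / (c * (c + 1)) * z * hyp2f1_series (a + 1) (b + 1) (c + 2) z"
proof -
  have c1: "c + 1 \<notin> \<int>\<^sub>\<le>\<^sub>0" "c + 2 \<notin> \<int>\<^sub>\<le>\<^sub>0"
    using c plus_one_in_nonpos_Ints_imp[of c] plus_one_in_nonpos_Ints_imp[of "c + 1"]
    by (auto simp: add.assoc)
  define u where "u a b c k = pochhammer a k * pochhammer b k / (pochhammer c k * fact k) * z ^ k" for a b c k
  have sums: "u a b c sums hyp2f1_series a b c z" if "c \<notin> \<int>\<^sub>\<le>\<^sub>0" for a b c
    using summable_hyp2f1[OF that z] unfolding u_def hyp2f1_series_def by (rule summable_sums)
  have "(\<lambda>k. u (a + 1) b (c + 1) (Suc k) - b * (c - a) / (c * (c + 1)) * z * u (a + 1) (b + 1) (c + 2) k)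
      sums (hyp2f1_series (a + 1) b (c + 1) z - u (a + 1) b (c + 1) 0
        - b * (c - a) / (c * (c + 1)) * z * hyp2f1_series (a + 1) (b + 1) (c + 2) z)"
    using sums[OF c1(1)] sums[OF c1(2)]
    by (intro sums_diff sums_mult) (auto simp: sums_Suc_iff)
  moreover have "u (a + 1) b (c + 1) (Suc k) - b * (c - a) / (c * (c + 1)) * z * u (a + 1) (b + 1) (c + 2) k
      = u a b c (Suc k)" for k
  proof -
    define A where "A = pochhammer (a + 1) k"
    define B where "B = pochhammer (b + 1) k"
    define C where "C = pochhammer (c + 2) k"
    define K where "K = complex_of_nat k"
    have nz: "c \<noteq> 0" "c + 1 \<noteq> 0" "C \<noteq> 0" "c + 1 + K \<noteq> 0" "K + 1 \<noteq> 0"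
    proof -
      show "c \<noteq> 0" "c + 1 \<noteq> 0" using c c1 by auto
      show "C \<noteq> 0" using c1 pochhammer_eq_0_imp_nonpos_Int by (auto simp: C_def)
      show "c + 1 + K \<noteq> 0" unfolding K_def using c1 plus_of_nat_eq_0_imp[of "c + 1" k]
        by (metis minus_of_nat_in_nonpos_Ints)
      show "K + 1 \<noteq> 0" unfolding K_def by (metis of_nat_Suc of_nat_neq_0 add.commute)
    qed
    have p: "pochhammer (a + 1) (Suc k) = A * (a + 1 + K)" "pochhammer b (Suc k) = b * B"
       "pochhammer a (Suc k) = a * A" "pochhammer (c + 1) (Suc k) = (c + 1) * C"
       "pochhammer c (Suc k) * (c + 1 + K) = c * ((c + 1) * C)"
       "(fact (Suc k) :: complex) = (K + 1) * fact k"
    proof -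
      show "pochhammer (a + 1) (Suc k) = A * (a + 1 + K)" by (simp add: A_def K_def pochhammer_Suc)
      show "pochhammer b (Suc k) = b * B" "pochhammer a (Suc k) = a * A"
        by (simp_all add: A_def B_def pochhammer_rec)
      show C: "pochhammer (c + 1) (Suc k) = (c + 1) * C"
        by (simp add: C_def pochhammer_rec add.assoc)
      have "pochhammer c (Suc k) * (c + 1 + K) = pochhammer c (Suc (Suc k))"
        by (simp only: pochhammer_Suc[of c "Suc k"] K_def) (simp add: add_ac)
      also have "\<dots> = c * pochhammer (c + 1) (Suc k)" by (rule pochhammer_rec)
      finally show "pochhammer c (Suc k) * (c + 1 + K) = c * ((c + 1) * C)" by (simp only: C)
      show "(fact (Suc k) :: complex) = (K + 1) * fact k" by (simp add: K_def add.commute)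
    qed
    define G where "G = A * B * b * z ^ Suc k / (c * (c + 1) * C * ((K + 1) * fact k))"
    have pc: "pochhammer c (Suc k) = c * ((c + 1) * C) / (c + 1 + K)"
      using p(5) nz by (simp add: field_simps)
    have "u (a + 1) b (c + 1) (Suc k) = G * (c * (a + 1 + K))"
      unfolding u_def p G_def using nz by (simp add: mult_ac)
    moreover have "b * (c - a) / (c * (c + 1)) * z * u (a + 1) (b + 1) (c + 2) k = G * ((c - a) * (K + 1))"
      unfolding u_def A_def[symmetric] B_def[symmetric] C_def[symmetric] G_def using nz by (simp add: mult_ac)
    moreover have "u a b c (Suc k) = G * (a * (c + 1 + K))"
      unfolding u_def p pc G_def using nz by (simp add: mult_ac)
    moreover have "c * (a + 1 + K) - (c - a) * (K + 1) = a * (c + 1 + K)"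
      by (simp add: algebra_simps)
    ultimately show ?thesis by (simp only: right_diff_distrib[symmetric])
  qed
  ultimately have "(\<lambda>k. u a b c (Suc k))
      sums (hyp2f1_series (a + 1) b (c + 1) z - u (a + 1) b (c + 1) 0
        - b * (c - a) / (c * (c + 1)) * z * hyp2f1_series (a + 1) (b + 1) (c + 2) z)" by simp
  moreover have "(\<lambda>k. u a b c (Suc k)) sums (hyp2f1_series a b c z - u a b c 0)"
    using sums[OF c] by (auto simp: sums_Suc_iff)
  ultimately have "hyp2f1_series (a + 1) b (c + 1) z - u (a + 1) b (c + 1) 0
        - b * (c - a) / (c * (c + 1)) * z * hyp2f1_series (a + 1) (b + 1) (c + 2) z
        = hyp2f1_series a b c z - u a b c 0"
    by (rule sums_unique2)
  then show ?thesis by (simp add: u_def)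
qed

text \<open>The relation serves here to construct a continuation: the two sets of raised parameters
  determine one for the original parameters.\<close>

lemma has_2f1_continuation_gauss:
  assumes c: "c \<notin> \<int>\<^sub>\<le>\<^sub>0"
    and "has_2f1_continuation (a + 1) b (c + 1) f" "has_2f1_continuation (a + 1) (b + 1) (c + 2) g"
  shows "has_2f1_continuation a b c (\<lambda>z. f z - b * (c - a) / (c * (c + 1)) * z * g z)"
  using assms(2,3) gauss_contiguous_series[OF c] unfolding has_2f1_continuation_def
  by (auto intro!: holomorphic_intros)

section \<open>Euler's integral\<close>

definition euler_integral :: "complex \<Rightarrow> complex \<Rightarrow> complex \<Rightarrow> complex \<Rightarrow> complex" where
  "euler_integral a b c z = integral {0..1}
     (\<lambda>t. of_real t powr (b - 1) * of_real (1 - t) powr (c - b - 1) * (1 - z * of_real t) powr (- a))"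

text \<open>Explains the bounds Re b > 1 and Re (c - b) > 1 below: with them the exponents b - 1 and
  c - b - 1 have positive real part, and the integrand is continuous up to both endpoints.\<close>

lemma continuous_on_of_real_powr:
  assumes "Re s > 0"
  shows "continuous_on {0..1} (\<lambda>t. complex_of_real t powr s)"
    "continuous_on {0..1} (\<lambda>t. complex_of_real (1 - t) powr s)"
  using assms by (auto intro!: continuous_intros)

text \<open>With a = 0 and z = 0 the integral is the Beta function B(b, c - b). Its functional
  equation follows from two facts: the derivative of t^b (1 - t)^(c - b) integrates to 0, and t + (1
  - t) = 1.\<close>

lemma euler_integral_zero_step:
  assumes b: "Re b > 1" and c: "Re (c - b) > 1"
  shows "c * euler_integral 0 (b + 1) (c + 1) 0 = b * euler_integral 0 b c 0"
proof -
  define T where "T s t = complex_of_real t powr s" for s t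
  define U where "U s t = complex_of_real (1 - t) powr s" for s t
  have d: "((\<lambda>t. T b t * U (c - b) t) has_vector_derivative
       (b * (T (b - 1) t * U (c - b) t) - (c - b) * (T b t * U (c - b - 1) t))) (at t)"
    if t: "t \<in> {0<..<1}" for t
  proof -
    have nz: "complex_of_real t \<notin> \<real>\<^sub>\<le>\<^sub>0" "1 - complex_of_real t \<notin> \<real>\<^sub>\<le>\<^sub>0"
      using t by (auto simp: complex_nonpos_Reals_iff)
    have "((\<lambda>z. z powr b * (1 - z) powr (c - b)) has_field_derivative
        (b * (of_real t powr (b - 1) * (1 - of_real t) powr (c - b))
         - (c - b) * (of_real t powr b * (1 - of_real t) powr (c - b - 1)))) (at (of_real t))"
      using nz by (auto intro!: derivative_eq_intros simp: algebra_simps)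
    from has_vector_derivative_real_field[OF this] show ?thesis
      by (simp add: T_def U_def)
  qed
  have "((\<lambda>t. b * (T (b - 1) t * U (c - b) t) - (c - b) * (T b t * U (c - b - 1) t))
      has_integral (T b 1 * U (c - b) 1 - T b 0 * U (c - b) 0)) {0..1}"
  proof (rule fundamental_theorem_of_calculus_interior[OF _ _ d])
    show "continuous_on {0..1} (\<lambda>t. T b t * U (c - b) t)"
      unfolding T_def U_def using b c by (intro continuous_on_mult continuous_on_of_real_powr) auto
  qed auto
  then have I0: "((\<lambda>t. b * (T (b - 1) t * U (c - b) t) - (c - b) * (T b t * U (c - b - 1) t))
      has_integral 0) {0..1}"
    by (simp add: T_def U_def)
  have int: "((\<lambda>t. T p t * U q t) has_integral integral {0..1} (\<lambda>t. T p t * U q t)) {0..1}"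
    if "Re p > 0" "Re q > 0" for p q
    unfolding T_def U_def using that
    by (intro integrable_integral integrable_continuous_interval continuous_on_mult continuous_on_of_real_powr)
  define X where "X = integral {0..1} (\<lambda>t. T (b - 1) t * U (c - b - 1) t)"
  define Y where "Y = integral {0..1} (\<lambda>t. T b t * U (c - b - 1) t)"
  define Z where "Z = integral {0..1} (\<lambda>t. T (b - 1) t * U (c - b) t)"
  have X: "((\<lambda>t. T (b - 1) t * U (c - b - 1) t) has_integral X) {0..1}"
    unfolding X_def using b c by (intro int) auto
  have Y: "((\<lambda>t. T b t * U (c - b - 1) t) has_integral Y) {0..1}"
    unfolding Y_def using b c by (intro int) auto
  have Z: "((\<lambda>t. T (b - 1) t * U (c - b) t) has_integral Z) {0..1}"
    unfolding Z_def using b c by (intro int) auto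
  have "((\<lambda>t. b * (T (b - 1) t * U (c - b) t) - (c - b) * (T b t * U (c - b - 1) t))
      has_integral (b * Z - (c - b) * Y)) {0..1}"
    by (intro has_integral_diff has_integral_mult_right Y Z)
  with I0 have 1: "b * Z - (c - b) * Y = 0" by (rule has_integral_unique[rotated])
  have "((\<lambda>t. T b t * U (c - b - 1) t + T (b - 1) t * U (c - b) t) has_integral (Y + Z)) {0..1}"
    by (intro has_integral_add Y Z)
  moreover have "T b t * U (c - b - 1) t + T (b - 1) t * U (c - b) t = T (b - 1) t * U (c - b - 1) t"
    if "t \<in> {0..1}" for t
  proof -
    have "x powr p = x * x powr (p - 1)" for x p :: complex
      using powr_add[of x 1 "p - 1"] by (cases "x = 0") auto
    then have e: "T b t = of_real t * T (b - 1) t" "U (c - b) t = of_real (1 - t) * U (c - b - 1) t"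
      unfolding T_def U_def by blast+
    have "T b t * U (c - b - 1) t + T (b - 1) t * U (c - b) t
        = (of_real t + of_real (1 - t)) * (T (b - 1) t * U (c - b - 1) t)"
      unfolding e by (subst distrib_right) (simp only: mult_ac)
    also have "of_real t + of_real (1 - t) = (1 :: complex)" by (simp flip: of_real_add)
    finally show ?thesis by simp
  qed
  ultimately have "((\<lambda>t. T (b - 1) t * U (c - b - 1) t) has_integral (Y + Z)) {0..1}"
    by (rule has_integral_eq[rotated])
  with X have 2: "X = Y + Z" by (rule has_integral_unique)
  have "c * Y = b * X" using 1 unfolding 2 by (simp add: algebra_simps)
  then show ?thesis
    by (simp add: X_def Y_def T_def U_def euler_integral_def algebra_simps)
qed

lemma euler_integral_zero_moments:
  assumes b: "Re b > 1" and c: "Re (c - b) > 1"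
  shows "euler_integral 0 (b + of_nat k) (c + of_nat k) 0 = pochhammer b k / pochhammer c k * euler_integral 0 b c 0"
proof (induction k)
  case (Suc k)
  have nz: "c + of_nat k \<noteq> 0" using b c by (auto simp: complex_eq_iff)
  have "(c + of_nat k) * euler_integral 0 (b + of_nat k + 1) (c + of_nat k + 1) 0
      = (b + of_nat k) * euler_integral 0 (b + of_nat k) (c + of_nat k) 0"
    using b c by (intro euler_integral_zero_step) auto
  then have "euler_integral 0 (b + of_nat k + 1) (c + of_nat k + 1) 0
      = (b + of_nat k) * euler_integral 0 (b + of_nat k) (c + of_nat k) 0 / (c + of_nat k)"
    using nz by (simp add: nonzero_eq_divide_eq mult.commute)
  then show ?case unfolding Suc
    by (simp add: pochhammer_Suc add_ac mult_ac)
qed simp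

text \<open>The binomial series of (1 - z t)^(- a) converges uniformly in t and is integrated term
  by term; the moments of the Beta weight supply the quotients of Pochhammer symbols in b and
  c.\<close>

lemma euler_integral_eq_series:
  assumes b: "Re b > 1" and c: "Re (c - b) > 1" and z: "norm z < 1"
  shows "euler_integral a b c z = euler_integral 0 b c 0 * hyp2f1_series a b c z"
proof -
  define w where "w t = of_real t powr (b - 1) * of_real (1 - t) powr (c - b - 1)" for t :: real
  have cont_w: "continuous_on {0..1} w"
    unfolding w_def using b c by (intro continuous_on_mult continuous_on_of_real_powr) auto
  define q where "q k = ((- a) gchoose k) * (- z) ^ k" for k
  have "bounded (w ` {0..1})"
    using cont_w by (intro compact_imp_bounded compact_continuous_image) auto
  then obtain B where B: "\<And>t. t \<in> {0..1} \<Longrightarrow> norm (w t) \<le> B"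
    unfolding bounded_iff by blast
  have "norm (w 0) \<le> B" by (rule B) simp
  then have B0: "B \<ge> 0" by (rule order.trans[OF norm_ge_zero])
  have q: "summable (\<lambda>k. norm (q k))"
    unfolding q_def using z
    by (intro abs_summable_in_conv_radius) (auto simp: conv_radius_gchoose)
  have expand: "(\<lambda>k. w t * (q k * of_real t ^ k)) sums (w t * (1 - z * of_real t) powr (- a))"
    if t: "t \<in> {0..1}" for t
  proof -
    have "norm (- z * of_real t) \<le> norm z * 1"
      unfolding norm_mult norm_minus_cancel using t by (intro mult_left_mono) auto
    then have "(\<lambda>k. ((- a) gchoose k) * (- z * of_real t) ^ k) sums (1 + - z * of_real t) powr (- a)"
      using z by (intro gen_binomial_complex) auto
    then have "(\<lambda>k. q k * of_real t ^ k) sums (1 - z * of_real t) powr (- a)"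
      unfolding q_def power_mult_distrib by (simp only: mult.assoc mult_minus_left diff_conv_add_uminus)
    then show ?thesis by (rule sums_mult)
  qed
  have unif: "uniform_limit {0..1} (\<lambda>n t. \<Sum>k<n. w t * (q k * of_real t ^ k))
      (\<lambda>t. \<Sum>k. w t * (q k * of_real t ^ k)) sequentially"
  proof (rule Weierstrass_m_test)
    show "summable (\<lambda>k. B * norm (q k))" by (intro summable_mult q)
    show "norm (w t * (q k * of_real t ^ k)) \<le> B * norm (q k)" if t: "t \<in> {0..1}" for k t
    proof -
      have "norm (q k) * \<bar>t\<bar> ^ k \<le> norm (q k) * 1"
        using t by (intro mult_left_mono power_le_one) auto
      then show ?thesis
        using B[OF t] B0 unfolding norm_mult norm_power norm_of_real
        by (intro mult_mono) auto
    qed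
  qed
  obtain I J where I: "\<And>n. ((\<lambda>t. \<Sum>k<n. w t * (q k * of_real t ^ k)) has_integral I n) {0..1}"
    and J: "((\<lambda>t. \<Sum>k. w t * (q k * of_real t ^ k)) has_integral J) {0..1}" and IJ: "I \<longlonglongrightarrow> J"
    by (rule uniform_limit_integral[OF unif]) (auto intro!: continuous_intros cont_w)
  have "J = euler_integral a b c z"
  proof -
    have "((\<lambda>t. w t * (1 - z * of_real t) powr (- a)) has_integral J) {0..1}"
      using J by (rule has_integral_eq[rotated]) (use expand in \<open>auto simp: sums_iff\<close>)
    then show ?thesis unfolding euler_integral_def w_def by (simp add: integral_unique)
  qed
  have mom: "((\<lambda>t. w t * of_real t ^ k) has_integral pochhammer b k / pochhammer c k * euler_integral 0 b c 0) {0..1}" for k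
  proof -
    have "w t * of_real t ^ k = of_real t powr (b + of_nat k - 1) *
        of_real (1 - t) powr (c + of_nat k - (b + of_nat k) - 1)" if "t \<in> {0..1}" for t
    proof (cases "t = 0")
      case False
      then have "of_real t powr (b + of_nat k - 1) = of_real t powr (b - 1) * of_real t ^ k"
        using powr_add[of "of_real t" "b - 1" "of_nat k"] by (simp add: algebra_simps)
      then show ?thesis by (simp add: w_def)
    qed (simp add: w_def)
    moreover have "((\<lambda>t. w t * of_real t ^ k) has_integral integral {0..1} (\<lambda>t. w t * of_real t ^ k)) {0..1}"
      by (intro integrable_integral integrable_continuous_interval continuous_intros cont_w)
    moreover have "integral {0..1} (\<lambda>t. w t * of_real t ^ k) = euler_integral 0 (b + of_nat k) (c + of_nat k) 0"
      unfolding euler_integral_def by (rule integral_cong) (simp add: calculation(1))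
    ultimately show ?thesis using euler_integral_zero_moments[OF b c, of k] by simp
  qed
  have "I n = (\<Sum>k<n. euler_integral 0 b c 0 * (pochhammer a k * pochhammer b k / (pochhammer c k * fact k) * z ^ k))" for n
  proof -
    have "((\<lambda>t. \<Sum>k<n. q k * (w t * of_real t ^ k)) has_integral
        (\<Sum>k<n. q k * (pochhammer b k / pochhammer c k * euler_integral 0 b c 0))) {0..1}"
      by (intro has_integral_sum has_integral_mult_right mom) auto
    then have "((\<lambda>t. \<Sum>k<n. w t * (q k * of_real t ^ k)) has_integral
        (\<Sum>k<n. q k * (pochhammer b k / pochhammer c k * euler_integral 0 b c 0))) {0..1}"
      by (simp only: mult_ac)
    then have "I n = (\<Sum>k<n. q k * (pochhammer b k / pochhammer c k * euler_integral 0 b c 0))"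
      using I has_integral_unique by blast
    moreover have "q k = pochhammer a k / fact k * z ^ k" for k
      unfolding q_def gbinomial_pochhammer by (simp add: power_minus[of z])
    ultimately show ?thesis by (simp add: mult_ac)
  qed
  then have "I = (\<lambda>n. \<Sum>k<n. euler_integral 0 b c 0 * (pochhammer a k * pochhammer b k / (pochhammer c k * fact k) * z ^ k))"
    by (rule ext)
  then have "(\<lambda>k. euler_integral 0 b c 0 * (pochhammer a k * pochhammer b k / (pochhammer c k * fact k) * z ^ k)) sums J"
    using IJ unfolding sums_def by (simp only:)
  moreover have "c \<notin> \<int>\<^sub>\<le>\<^sub>0"
    using b c by (auto elim!: nonpos_Ints_cases)
  then have "(\<lambda>k. euler_integral 0 b c 0 * (pochhammer a k * pochhammer b k / (pochhammer c k * fact k) * z ^ k))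
      sums (euler_integral 0 b c 0 * hyp2f1_series a b c z)"
    unfolding hyp2f1_series_def by (intro sums_mult summable_sums summable_hyp2f1 z)
  ultimately have "J = euler_integral 0 b c 0 * hyp2f1_series a b c z"
    by (rule sums_unique2)
  with \<open>J = euler_integral a b c z\<close> show ?thesis by simp
qed

text \<open>Holomorphy is local, and balls inside the cut plane provide the convex domains on which
  one may differentiate under the integral.\<close>

lemma euler_integral_holomorphic:
  assumes b: "Re b > 1" and c: "Re (c - b) > 1"
  shows "euler_integral a b c holomorphic_on cut_plane"
proof -
  define w where "w t = of_real t powr (b - 1) * of_real (1 - t) powr (c - b - 1)" for t :: real
  have cont_w: "continuous_on {0..1} w"
    unfolding w_def using b c by (intro continuous_on_mult continuous_on_of_real_powr) auto
  have "euler_integral a b c holomorphic_on ball z r" if r: "ball z r \<subseteq> cut_plane" for z r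
  proof -
    have nr: "1 - x * of_real t \<notin> \<real>\<^sub>\<le>\<^sub>0" if "x \<in> ball z r" "t \<in> {0..1}" for x t
      using that r cut_plane_one_minus by blast
    have nz: "1 - x * of_real t \<noteq> 0" "Re (1 - x * of_real t) \<ge> 0 \<or> Im (1 - x * of_real t) \<noteq> 0"
      if "x \<in> ball z r" "t \<in> {0..1}" for x t
    proof -
      show "1 - x * of_real t \<noteq> 0" using nr[OF that] by (metis nonpos_Reals_zero_I)
      show "Re (1 - x * of_real t) \<ge> 0 \<or> Im (1 - x * of_real t) \<noteq> 0"
        using nr[OF that] unfolding complex_nonpos_Reals_iff by (meson linear)
    qed
    have "(\<lambda>x. integral (cbox 0 1) (\<lambda>t. w t * (1 - x * of_real t) powr (- a))) holomorphic_on ball z r"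
    proof (rule leibniz_rule_holomorphic)
      show "((\<lambda>x. w t * (1 - x * of_real t) powr (- a)) has_field_derivative
          w t * (a * of_real t * (1 - x * of_real t) powr (- a - 1))) (at x within ball z r)"
        if "x \<in> ball z r" "t \<in> cbox 0 1" for x and t :: real
      proof -
        have "((\<lambda>x. w t * (1 - x * of_real t) powr (- a)) has_field_derivative
            w t * (a * of_real t * (1 - x * of_real t) powr (- a - 1))) (at x)"
          using nr[of x t] that by (auto intro!: derivative_eq_intros)
        then show ?thesis by (rule has_field_derivative_at_within)
      qed
      show "(\<lambda>t. w t * (1 - x * of_real t) powr (- a)) integrable_on cbox 0 1" if "x \<in> ball z r" for x
        using nz[OF that] cont_w
        by (intro integrable_continuous continuous_on_mult continuous_on_powr_complex continuous_intros) auto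
      have "continuous_on (ball z r \<times> cbox 0 1) (\<lambda>p. w (snd p))"
        by (rule continuous_on_compose2[OF cont_w continuous_on_snd]) (auto intro: continuous_intros)
      moreover have "continuous_on (ball z r \<times> cbox 0 1)
          (\<lambda>p. (1 - fst p * of_real (snd p)) powr (- a - 1))"
      proof (rule continuous_on_powr_complex)
        show "ball z r \<times> cbox 0 1 \<subseteq>
            {p. 0 \<le> Re (1 - fst p * of_real (snd p)) \<or> Im (1 - fst p * of_real (snd p)) \<noteq> 0}"
        proof (intro subsetI CollectI)
          fix p :: "complex \<times> real" assume "p \<in> ball z r \<times> cbox 0 1"
          then show "0 \<le> Re (1 - fst p * of_real (snd p)) \<or> Im (1 - fst p * of_real (snd p)) \<noteq> 0"
            by (intro nz(2)) auto
        qed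
        \<comment> \<open>Vacuous: the base has no zero on this set.\<close>
        show "0 < Re (- a - 1)" if "p \<in> ball z r \<times> cbox 0 1" "1 - fst p * of_real (snd p) = 0" for p
          using that nz(1)[of "fst p" "snd p"] by auto
      qed (intro continuous_intros)+
      ultimately show "continuous_on (ball z r \<times> cbox 0 1)
          (\<lambda>(x, t). w t * (a * of_real t * (1 - x * of_real t) powr (- a - 1)))"
        unfolding case_prod_beta
        by (intro continuous_on_mult continuous_on_const continuous_on_of_real continuous_on_snd continuous_on_id)
    qed auto
    then show ?thesis
      unfolding w_def euler_integral_def[abs_def] by simp
  qed
  note ball = this
  show ?thesis
    unfolding holomorphic_on_def
  proof
    fix z assume "z \<in> cut_plane"
    then obtain r where r: "r > 0" "ball z r \<subseteq> cut_plane"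
      using open_cut_plane unfolding open_contains_ball by blast
    then have "euler_integral a b c field_differentiable (at z)"
      by (intro holomorphic_on_imp_differentiable_at[OF ball]) auto
    then show "euler_integral a b c field_differentiable (at z within cut_plane)"
      by (rule field_differentiable_at_within)
  qed
qed

text \<open>That the Beta constant is nonzero stays a hypothesis; for large shifts of the parameters
  it will follow from the nonzero limit of the rescaled constant.\<close>

lemma has_2f1_continuation_euler_integral:
  assumes "Re b > 1" "Re (c - b) > 1" "euler_integral 0 b c 0 \<noteq> 0"
  shows "has_2f1_continuation a b c (\<lambda>z. euler_integral a b c z / euler_integral 0 b c 0)"
  unfolding has_2f1_continuation_def
proof
  show "(\<lambda>z. euler_integral a b c z / euler_integral 0 b c 0) holomorphic_on cut_plane"
    by (intro holomorphic_on_divide euler_integral_holomorphic holomorphic_on_const assms)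
  show "\<forall>z\<in>ball 0 1. euler_integral a b c z / euler_integral 0 b c 0 = hyp2f1_series a b c z"
  proof
    fix z :: complex assume "z \<in> ball 0 1"
    then have "euler_integral a b c z = euler_integral 0 b c 0 * hyp2f1_series a b c z"
      by (intro euler_integral_eq_series assms) simp
    then show "euler_integral a b c z / euler_integral 0 b c 0 = hyp2f1_series a b c z"
      using assms(3) by (simp only: nonzero_mult_div_cancel_left not_False_eq_True)
  qed
qed

section \<open>Hypergeometric functions with large parameters\<close>

lemma of_real_powr_eq_exp:
  "x > 0 \<Longrightarrow> complex_of_real x powr y = exp (y * of_real (ln x))"
  by (simp add: powr_def Ln_of_real)

lemma euler_integral_at_zero: "euler_integral a b c 0 = euler_integral 0 b c 0"
  by (simp add: euler_integral_def)

context below_one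
begin

definition w :: real where "w = (1 - s) / (1 + s)"

lemma w: "\<bar>w\<bar> < 1" "1 + w = 2 * t0" "1 - w = s * (1 + w)" "w / (1 + w)\<^sup>2 = z / 4"
proof -
  have s1: "1 + s > 0" using s(1) by simp
  then show "\<bar>w\<bar> < 1" using s(1) by (auto simp: w_def abs_less_iff field_simps)
  show eq: "1 + w = 2 * t0" using s1 by (simp add: w_def t0_def field_simps)
  show "1 - w = s * (1 + w)" using s1 by (simp add: w_def field_simps)
  have "w / (1 + w)\<^sup>2 = (1 - s) * (1 + s) / 4"
    unfolding eq using s1 by (simp add: w_def t0_def power2_eq_square)
  then show "w / (1 + w)\<^sup>2 = z / 4" by (simp only: s(3)[symmetric])
qed

text \<open>Raising (a, b, c) by (m, m, 2 m) multiplies the integrand by \<phi>^m, so Laplace's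
  method applies with a fixed g.\<close>

lemma euler_integral_half_rate:
  assumes b: "Re b > 1" and c: "Re (c - b) > 1"
  shows "half_rate (\<lambda>m. of_real ((1 + s) ^ (2 * m)) *
      euler_integral (a + of_nat m) (b + of_nat m) (c + 2 * of_nat m) (of_real z) / of_real (wallis m))
      (of_real t0 powr (c - 1) * of_real s powr (c - a - b - 1 / 2))"
proof -
  define g where "g t = of_real t powr (b - 1) * of_real (1 - t) powr (c - b - 1)
      * (1 - of_real z * of_real t) powr (- a)" for t :: real
  have arg: "1 - complex_of_real z * of_real t \<notin> \<real>\<^sub>\<le>\<^sub>0" if "t \<in> {0..1}" for t
    using pos[OF that] by (auto simp: complex_nonpos_Reals_iff)
  have cont: "continuous_on {0..1} g"
  proof -
    have "continuous_on {0..1} (\<lambda>t. (1 - of_real z * of_real t) powr (- a) :: complex)"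
    proof (rule continuous_on_powr_complex)
      show "{0..1} \<subseteq> {t. 0 \<le> Re (1 - complex_of_real z * complex_of_real t) \<or>
          Im (1 - complex_of_real z * complex_of_real t) \<noteq> 0}"
        using pos by (auto intro: less_imp_le)
      show "0 < Re (- a)" if "t \<in> {0..1}" "1 - complex_of_real z * complex_of_real t = 0" for t
        using that arg[of t] by (metis nonpos_Reals_zero_I)
    qed (intro continuous_intros)+
    then show ?thesis
      unfolding g_def using b c by (intro continuous_on_mult continuous_on_of_real_powr) auto
  qed
  have t0_in: "t0 \<in> {0..1}" using t0(1) by auto
  have "\<exists>d. (g has_vector_derivative d) (at t0)"
  proof -
    have "complex_of_real t0 \<notin> \<real>\<^sub>\<le>\<^sub>0" "1 - complex_of_real t0 \<notin> \<real>\<^sub>\<le>\<^sub>0"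
      using t0(1) by (auto simp: complex_nonpos_Reals_iff)
    then have "(\<lambda>x. x powr (b - 1) * (1 - x) powr (c - b - 1) * (1 - of_real z * x) powr (- a))
        analytic_on {of_real t0}"
      using arg[OF t0_in] by (intro analytic_intros) auto
    then have "(\<lambda>x. x powr (b - 1) * (1 - x) powr (c - b - 1) * (1 - of_real z * x) powr (- a))
        field_differentiable at (of_real t0)"
      by (rule analytic_on_imp_differentiable_at) simp
    then obtain d where "((\<lambda>x. x powr (b - 1) * (1 - x) powr (c - b - 1) * (1 - of_real z * x) powr (- a))
        has_field_derivative d) (at (of_real t0))"
      by (auto simp: field_differentiable_def)
    from has_vector_derivative_real_field[OF this] show ?thesis
      unfolding g_def by auto
  qed
  then obtain d where d: "(g has_vector_derivative d) (at t0)" by blast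
  have "euler_integral (a + of_nat m) (b + of_nat m) (c + 2 * of_nat m) (of_real z)
      = integral {0..1} (\<lambda>t. of_real (\<phi> t ^ m) * g t)" for m
    unfolding euler_integral_def
  proof (rule integral_cong)
    fix t :: real assume t: "t \<in> {0..1}"
    have pw0: "of_real x powr (p + of_nat m) = of_real x powr p * of_real x ^ m"
      for x :: real and p :: complex
      by (cases "x = 0") (simp_all add: powr_add)
    have nz: "1 - complex_of_real z * of_real t \<noteq> 0" using arg[OF t] by (metis nonpos_Reals_zero_I)
    have e: "b + of_nat m - 1 = (b - 1) + of_nat m"
       "c + 2 * of_nat m - (b + of_nat m) - 1 = (c - b - 1) + of_nat m"
       "- (a + of_nat m) = - a - of_nat m" by simp_all
    have last: "(1 - complex_of_real z * of_real t) powr (- a - of_nat m)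
       = (1 - complex_of_real z * of_real t) powr (- a) / (1 - complex_of_real z * of_real t) ^ m"
      using nz by (simp add: powr_diff)
    have \<phi>: "complex_of_real (\<phi> t ^ m) = of_real t ^ m * of_real (1 - t) ^ m
        / (1 - complex_of_real z * of_real t) ^ m"
      by (simp add: \<phi>_def power_divide power_mult_distrib)
    show "of_real t powr (b + of_nat m - 1) * of_real (1 - t) powr (c + 2 * of_nat m - (b + of_nat m) - 1)
        * (1 - of_real z * of_real t) powr (- (a + of_nat m)) = of_real (\<phi> t ^ m) * g t"
      unfolding e pw0 last \<phi> g_def by (simp only: times_divide_eq_left times_divide_eq_right mult_ac)
  qed
  then have eq: "of_real ((1 + s) ^ (2 * m)) * euler_integral (a + of_nat m) (b + of_nat m) (c + 2 * of_nat m) (of_real z)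
      = integral {0..1} (\<lambda>t. of_real (((1 + s)\<^sup>2 * \<phi> t) ^ m) * g t)" for m
    by (simp only: integral_mult_right[symmetric])
       (simp only: power_mult power_mult_distrib of_real_mult mult.assoc)
  \<comment> \<open>At the saddle point 1 - t0 = s t0 and 1 - z t0 = s, while the Jacobian
    contributes t0 sqrt s. Adding the exponents gives c - 1 for t0 and c - a - b - 1 / 2 for
    s.\<close>
  have "g t0 / of_real (y' t0) = of_real t0 powr (c - 1) * of_real s powr (c - a - b - 1 / 2)"
  proof -
    have t0p: "t0 > 0" using t0(1) by simp
    have g0: "g t0 = of_real t0 powr (b - 1) * of_real (s * t0) powr (c - b - 1) * of_real s powr (- a)"
    proof -
      have "1 - complex_of_real z * of_real t0 = of_real (1 - z * t0)" by simp
      then show ?thesis unfolding g_def t0(2) t0(3) by simp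
    qed
    have "y' t0 = 1 / (t0 * sqrt s)" unfolding y'_t0 by (simp add: t0_def)
    then have "1 / complex_of_real (y' t0) = of_real t0 * of_real (sqrt s)" by simp
    also have "\<dots> = of_real (exp (ln t0 + ln (sqrt s)))"
      using t0p s(1) by (simp add: exp_add del: exp_of_real)
    also have "\<dots> = exp (of_real (ln t0) + of_real (ln s) / 2)"
      unfolding exp_of_real[symmetric] using s(1) by (simp add: ln_sqrt)
    finally have y0: "1 / complex_of_real (y' t0) = exp (of_real (ln t0) + of_real (ln s) / 2)" .
    have "g t0 / of_real (y' t0) = g t0 * (1 / of_real (y' t0))" by simp
    also have "\<dots> = exp ((c - 1) * of_real (ln t0) + (c - a - b - 1 / 2) * of_real (ln s))"
      unfolding g0 y0 using t0p s(1)
      by (simp add: of_real_powr_eq_exp ln_mult flip: exp_add of_real_mult) (simp add: algebra_simps)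
    also have "\<dots> = of_real t0 powr (c - 1) * of_real s powr (c - a - b - 1 / 2)"
      using t0p s(1) by (simp add: of_real_powr_eq_exp exp_add)
    finally show ?thesis .
  qed
  with laplace_method[OF cont d] show ?thesis
    unfolding eq by simp
qed

end

text \<open>The Beta constant is the case z = 0 of the same asymptotics, with saddle point 1 / 2. It
  is therefore normalised by the same \<open>wallis m\<close> as the numerator.\<close>

lemma euler_integral_zero_half_rate:
  assumes "Re b > 1" "Re (c - b) > 1"
  shows "half_rate (\<lambda>m. of_real (2 ^ (2 * m)) *
      euler_integral 0 (b + of_nat m) (c + 2 * of_nat m) 0 / of_real (wallis m))
      (of_real (1 / 2) powr (c - 1))"
proof -
  interpret Z: below_one 0 by standard simp
  have s: "Z.s = 1" by (simp add: Z.s_def)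
  then have "Z.t0 = 1 / 2" by (simp add: Z.t0_def)
  with Z.euler_integral_half_rate[OF assms, of 0] s show ?thesis
    by (simp add: euler_integral_at_zero[of "of_nat _"])
qed

context below_one
begin

text \<open>In the quotient of Euler's integral by its Beta constant \<open>wallis m\<close>
  cancels, and the scalings (1 + s)^(2 m) and 2^(2 m) combine because 1 + w = 2 / (1 + s). The
  nonzero limit of the rescaled Beta constant also yields the continuation.\<close>

lemma hyp2f1_half_rate_large:
  assumes b: "Re b > 1" and c: "Re (c - b) > 1"
  shows "half_rate (\<lambda>m. hyp2f1 (a + of_nat m) (b + of_nat m) (c + 2 * of_nat m) (of_real z) / (1 + of_real w) ^ (2 * m))
      ((1 + of_real w) powr (c - 1) * of_real s powr (c - a - b - 1 / 2))"
    and "\<forall>\<^sub>F m in sequentially. \<exists>f. has_2f1_continuation (a + of_nat m) (b + of_nat m) (c + 2 * of_nat m) f"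
proof -
  define X where "X m = euler_integral (a + of_nat m) (b + of_nat m) (c + 2 * of_nat m) (of_real z)" for m
  define Y where "Y m = euler_integral 0 (b + of_nat m) (c + 2 * of_nat m) 0" for m
  have half: "complex_of_real (1 / 2) powr (c - 1) \<noteq> 0" by simp
  note Y = euler_integral_zero_half_rate[OF b c, folded Y_def]
  have Ynz: "\<forall>\<^sub>F m in sequentially. Y m \<noteq> 0"
    using tendsto_imp_eventually_ne[OF half_rate_tendsto[OF Y] half] by eventually_elim auto
  have cont: "\<forall>\<^sub>F m in sequentially.
      has_2f1_continuation (a + of_nat m) (b + of_nat m) (c + 2 * of_nat m)
        (\<lambda>x. euler_integral (a + of_nat m) (b + of_nat m) (c + 2 * of_nat m) x / Y m)"
    using Ynz
  proof eventually_elim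
    case (elim m)
    then show ?case unfolding Y_def using b c
      by (intro has_2f1_continuation_euler_integral) auto
  qed
  then show "\<forall>\<^sub>F m in sequentially. \<exists>f. has_2f1_continuation (a + of_nat m) (b + of_nat m) (c + 2 * of_nat m) f"
    by eventually_elim blast
  have lim: "half_rate (\<lambda>m. (of_real ((1 + s) ^ (2 * m)) * X m / of_real (wallis m))
        / (of_real (2 ^ (2 * m)) * Y m / of_real (wallis m)))
      (of_real t0 powr (c - 1) * of_real s powr (c - a - b - 1 / 2) / of_real (1 / 2) powr (c - 1))"
    unfolding X_def by (intro half_rate_divide euler_integral_half_rate b c Y half)
  have W: "1 + complex_of_real w = of_real (2 * t0)" using w(2) by (metis of_real_1 of_real_add)
  have t0p: "t0 > 0" using t0(1) by simp
  have eq: "\<forall>\<^sub>F m in sequentially. hyp2f1 (a + of_nat m) (b + of_nat m) (c + 2 * of_nat m) (of_real z) / (1 + of_real w) ^ (2 * m)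
      = (of_real ((1 + s) ^ (2 * m)) * X m / of_real (wallis m)) / (of_real (2 ^ (2 * m)) * Y m / of_real (wallis m))"
    using cont eventually_gt_at_top[of 0]
  proof eventually_elim
    case (elim m)
    have h: "hyp2f1 (a + of_nat m) (b + of_nat m) (c + 2 * of_nat m) (of_real z) = X m / Y m"
      unfolding X_def using hyp2f1_eqI[OF elim(1) of_real_in_cut_plane[OF z]] .
    have "(1 + complex_of_real w) ^ (2 * m) = of_real (2 ^ (2 * m)) / of_real ((1 + s) ^ (2 * m))"
      unfolding W by (simp add: t0_def power_divide)
    moreover have "complex_of_real ((1 + s) ^ (2 * m)) \<noteq> 0" using s(1)
      by (simp only: of_real_eq_0_iff) simp
    moreover have "complex_of_real (wallis m) \<noteq> 0" using wallis_pos[OF elim(2)] by simp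
    ultimately show ?case unfolding h by (simp add: mult_ac)
  qed
  have L: "(1 + of_real w) powr (c - 1) * of_real s powr (c - a - b - 1 / 2)
      = of_real t0 powr (c - 1) * of_real s powr (c - a - b - 1 / 2) / of_real (1 / 2) powr (c - 1)"
  proof -
    have "(1 + of_real w) powr (c - 1) = complex_of_real t0 powr (c - 1) / of_real (1 / 2) powr (c - 1)"
    proof -
      have p: "2 * t0 > 0" "(0::real) < 1 / 2" using t0p by simp_all
      show ?thesis
        unfolding W of_real_powr_eq_exp[OF p(1)] of_real_powr_eq_exp[OF p(2)] of_real_powr_eq_exp[OF t0p]
          exp_diff[symmetric]
        using t0p by (simp add: ln_mult ln_div algebra_simps)
    qed
    then show ?thesis by simp
  qed
  from iffD2[OF half_rate_cong[OF eq L] lim] show "half_rate (\<lambda>m. hyp2f1 (a + of_nat m) (b + of_nat m) (c + 2 * of_nat m) (of_real z) / (1 + of_real w) ^ (2 * m))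
      ((1 + of_real w) powr (c - 1) * of_real s powr (c - a - b - 1 / 2))"
    .
qed

text \<open>Raising the parameters by (N, N, 2 N) is a shift of m. It preserves c - a - b, and the
  power of 1 + w gained in the limit is cancelled by the one in the normalisation; so large real
  parts may be assumed.\<close>

lemma hyp2f1_half_rate:
  shows "half_rate (\<lambda>m. hyp2f1 (a + of_nat m) (b + of_nat m) (c + 2 * of_nat m) (of_real z) / (1 + of_real w) ^ (2 * m))
      ((1 + of_real w) powr (c - 1) * of_real s powr (c - a - b - 1 / 2))" (is ?rate)
    and "\<forall>\<^sub>F m in sequentially. \<exists>f. has_2f1_continuation (a + of_nat m) (b + of_nat m) (c + 2 * of_nat m) f" (is ?cont)
proof -
  obtain N :: nat where N: "real N > 1 - Re b + \<bar>Re b\<bar> + \<bar>1 - Re (c - b)\<bar>"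
    using reals_Archimedean2 by blast
  have b: "Re (b + of_nat N) > 1" using N by (simp; linarith)
  have c: "Re (c + 2 * of_nat N - (b + of_nat N)) > 1" using N by (simp; linarith)
  have e: "x + of_nat N + of_nat m = x + of_nat (m + N)"
    "x + 2 * of_nat N + 2 * of_nat m = x + 2 * of_nat (m + N)" for x :: complex and m
    by (simp_all add: algebra_simps)
  note large = hyp2f1_half_rate_large[OF b c, of "a + of_nat N", unfolded e]
  from large(2) show ?cont
    using eventually_sequentially_seg[of "\<lambda>m. \<exists>f. has_2f1_continuation (a + of_nat m) (b + of_nat m) (c + 2 * of_nat m) f" N]
    by blast
  define W where "W = 1 + complex_of_real w"
  have W: "W \<noteq> 0"
  proof -
    have "1 + w \<noteq> 0" using w(1) by auto
    then show ?thesis unfolding W_def by (metis of_real_1 of_real_add of_real_eq_0_iff)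
  qed
  have lim: "half_rate (\<lambda>m. hyp2f1 (a + of_nat (m + N)) (b + of_nat (m + N)) (c + 2 * of_nat (m + N)) (of_real z) / W ^ (2 * m) / W ^ (2 * N))
     (W powr (c + 2 * of_nat N - 1) * of_real s powr (c + 2 * of_nat N - (a + of_nat N) - (b + of_nat N) - 1 / 2) / W ^ (2 * N))"
    using W by (intro half_rate_divide half_rate_const large(1)[folded W_def]) auto
  have pw: "W powr (c + 2 * of_nat N - 1) * S / W ^ (2 * N) = W powr (c - 1) * S" for S
  proof -
    have e: "c + 2 * of_nat N - 1 = (c - 1) + of_nat (2 * N)" by simp
    show ?thesis unfolding e powr_add powr_complexpow[OF W] using W by simp
  qed
  have ex: "c + 2 * of_nat N - (a + of_nat N) - (b + of_nat N) - 1 / 2 = c - a - b - 1 / 2" by simp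
  have den: "S / W ^ (2 * m) / W ^ (2 * N) = S / W ^ (2 * (m + N))" for S m
    by (simp add: power_add distrib_left)
  from lim have "half_rate (\<lambda>m. hyp2f1 (a + of_nat (m + N)) (b + of_nat (m + N)) (c + 2 * of_nat (m + N)) (of_real z) / W ^ (2 * (m + N)))
     (W powr (c - 1) * of_real s powr (c - a - b - 1 / 2))"
    unfolding pw ex den .
  from half_rate_of_offset[where u = "\<lambda>m. hyp2f1 (a + of_nat m) (b + of_nat m) (c + 2 * of_nat m) (of_real z) / W ^ (2 * m)", OF this]
  show ?rate unfolding W_def .
qed

end

definition gauss_numerator :: "complex \<Rightarrow> complex \<Rightarrow> complex \<Rightarrow> nat \<Rightarrow> complex \<Rightarrow> complex" where
  "gauss_numerator a b c n = hyp2f1 (a + of_nat (Suc n div 2)) (b + of_nat (n div 2)) (c + of_nat n)"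

section \<open>Gauss's continued fraction\<close>

lemma gauss_numerator_even:
  "gauss_numerator a b c (2 * m) = hyp2f1 (a + of_nat m) (b + of_nat m) (c + 2 * of_nat m)"
  by (simp add: gauss_numerator_def)

lemma gauss_numerator_odd:
  "gauss_numerator a b c (2 * m + 1) = hyp2f1 ((a + 1) + of_nat m) (b + of_nat m) ((c + 1) + 2 * of_nat m)"
  by (simp add: gauss_numerator_def algebra_simps)

lemma gauss_cf_coeff_Suc_even:
  "gauss_cf_coeff a b c z (Suc (2 * m)) =
     - ((b + of_nat m) * ((c + 2 * of_nat m) - (a + of_nat m)) / ((c + 2 * of_nat m) * ((c + 2 * of_nat m) + 1)) * z)"
proof -
  have e: "of_nat m + b = b + of_nat m" "of_nat m + c - a = c + 2 * of_nat m - (a + of_nat m)"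
    "2 * of_nat m + c = c + 2 * of_nat m" by simp_all
  show ?thesis
    using gauss_cf_coeff_odd[of a b c z m] unfolding e by (simp del: gauss_cf_coeff.simps)
qed

lemma gauss_cf_coeff_Suc_odd:
  "gauss_cf_coeff a b c z (Suc (2 * m + 1)) =
     - ((a + 1 + of_nat m) * ((c + 1 + 2 * of_nat m) - (b + of_nat m))
        / ((c + 1 + 2 * of_nat m) * ((c + 1 + 2 * of_nat m) + 1)) * z)"
proof -
  have e: "of_nat m + a + 1 = a + 1 + of_nat m" "of_nat m + c - b + 1 = c + 1 + 2 * of_nat m - (b + of_nat m)"
    "2 * of_nat m + c + 1 = c + 1 + 2 * of_nat m" "2 * of_nat m + c + 2 = c + 1 + 2 * of_nat m + 1" by simp_all
  show ?thesis
    using gauss_cf_coeff_even[of a b c z m] unfolding e by (simp del: gauss_cf_coeff.simps)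
qed

lemma nonpos_Ints_add_of_nat: "c \<notin> \<int>\<^sub>\<le>\<^sub>0 \<Longrightarrow> c + of_nat n \<notin> \<int>\<^sub>\<le>\<^sub>0"
  for c :: complex
proof (induction n)
  case (Suc n)
  then show ?case using plus_one_in_nonpos_Ints_imp[of "c + of_nat n"] by (auto simp: add_ac)
qed simp

definition gauss_continuable :: "complex \<Rightarrow> complex \<Rightarrow> complex \<Rightarrow> nat \<Rightarrow> bool" where
  "gauss_continuable a b c n \<longleftrightarrow>
     (\<exists>f. has_2f1_continuation (a + of_nat (Suc n div 2)) (b + of_nat (n div 2)) (c + of_nat n) f)"

text \<open>The same contiguous relation serves both parities: at even n it raises the first
  parameter, at odd n it is applied with the two upper parameters exchanged, by symmetry of the
  series.\<close>

lemma gauss_contiguous_step: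
  assumes c: "c \<notin> \<int>\<^sub>\<le>\<^sub>0"
    and "gauss_continuable a b c (Suc n)" "gauss_continuable a b c (Suc (Suc n))"
  shows "gauss_continuable a b c n"
    and "z \<in> cut_plane \<Longrightarrow> gauss_numerator a b c n z = gauss_numerator a b c (Suc n) z
         + gauss_cf_coeff a b c z (Suc n) * gauss_numerator a b c (Suc (Suc n)) z"
proof -
  have goal: "gauss_continuable a b c n \<and> (z \<in> cut_plane \<longrightarrow> gauss_numerator a b c n z = gauss_numerator a b c (Suc n) z
         + gauss_cf_coeff a b c z (Suc n) * gauss_numerator a b c (Suc (Suc n)) z)" for z
  proof (cases "even n")
    case True
    then obtain m where n: "n = 2 * m" by blast
    define A where "A = a + of_nat m"
    define B where "B = b + of_nat m"
    define C where "C = c + 2 * of_nat m"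
    have C: "C \<notin> \<int>\<^sub>\<le>\<^sub>0" unfolding C_def using nonpos_Ints_add_of_nat[OF c, of "2 * m"] by simp
    have e: "a + of_nat (Suc (Suc n) div 2) = A + 1" "b + of_nat (Suc n div 2) = B" "c + of_nat (Suc n) = C + 1"
       "a + of_nat (Suc (Suc (Suc n)) div 2) = A + 1" "b + of_nat (Suc (Suc n) div 2) = B + 1"
       "c + of_nat (Suc (Suc n)) = C + 2" "a + of_nat (Suc n div 2) = A" "b + of_nat (n div 2) = B" "c + of_nat n = C"
      by (simp_all add: n A_def B_def C_def)
    obtain f g where f: "has_2f1_continuation (A + 1) B (C + 1) f"
      and g: "has_2f1_continuation (A + 1) (B + 1) (C + 2) g"
      using assms(2,3) unfolding gauss_continuable_def e by blast
    note h = has_2f1_continuation_gauss[OF C f g]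
    have "gauss_cf_coeff a b c z (Suc n) = - (B * (C - A) / (C * (C + 1)) * z)"
      unfolding n A_def B_def C_def by (rule gauss_cf_coeff_Suc_even)
    then have "gauss_numerator a b c n z = gauss_numerator a b c (Suc n) z
         + gauss_cf_coeff a b c z (Suc n) * gauss_numerator a b c (Suc (Suc n)) z" if "z \<in> cut_plane"
      unfolding gauss_numerator_def e using hyp2f1_eqI[OF f that] hyp2f1_eqI[OF g that] hyp2f1_eqI[OF h that]
      by (simp del: gauss_cf_coeff.simps)
    then show ?thesis using h unfolding gauss_continuable_def e by blast
  next
    case False
    then obtain m where n: "n = 2 * m + 1" using oddE by blast
    define A where "A = a + 1 + of_nat m"
    define B where "B = b + of_nat m"
    define C where "C = c + 1 + 2 * of_nat m"
    have C: "C \<notin> \<int>\<^sub>\<le>\<^sub>0" unfolding C_def using nonpos_Ints_add_of_nat[OF c, of "Suc (2 * m)"]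
      by (simp add: add_ac)
    have e: "a + of_nat (Suc (Suc n) div 2) = A" "b + of_nat (Suc n div 2) = B + 1" "c + of_nat (Suc n) = C + 1"
       "a + of_nat (Suc (Suc (Suc n)) div 2) = A + 1" "b + of_nat (Suc (Suc n) div 2) = B + 1"
       "c + of_nat (Suc (Suc n)) = C + 2" "a + of_nat (Suc n div 2) = A" "b + of_nat (n div 2) = B" "c + of_nat n = C"
      by (simp_all add: n A_def B_def C_def)
    obtain f g where f: "has_2f1_continuation (B + 1) A (C + 1) f"
      and g: "has_2f1_continuation (B + 1) (A + 1) (C + 2) g"
      using assms(2,3) unfolding gauss_continuable_def e has_2f1_continuation_commute[of _ "B + 1"] by blast
    note h = has_2f1_continuation_gauss[OF C f g]
    have "gauss_cf_coeff a b c z (Suc n) = - (A * (C - B) / (C * (C + 1)) * z)"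
      unfolding n A_def B_def C_def by (rule gauss_cf_coeff_Suc_odd)
    then have "gauss_numerator a b c n z = gauss_numerator a b c (Suc n) z
         + gauss_cf_coeff a b c z (Suc n) * gauss_numerator a b c (Suc (Suc n)) z" if "z \<in> cut_plane"
      unfolding gauss_numerator_def e hyp2f1_commute[of _ B] hyp2f1_commute[of _ "B + 1"]
      using hyp2f1_eqI[OF f that] hyp2f1_eqI[OF g that] hyp2f1_eqI[OF h that]
      by (simp del: gauss_cf_coeff.simps)
    then show ?thesis using h unfolding gauss_continuable_def e has_2f1_continuation_commute[of _ B] by blast
  qed
  show "gauss_continuable a b c n" using goal by blast
  show "z \<in> cut_plane \<Longrightarrow> gauss_numerator a b c n z = gauss_numerator a b c (Suc n) z
         + gauss_cf_coeff a b c z (Suc n) * gauss_numerator a b c (Suc (Suc n)) z" using goal by blast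
qed

text \<open>Far out Euler's integral provides continuations for both parities; the contiguous
  relation brings them down, a pair of consecutive indices at a time.\<close>

lemma gauss_continuable_all:
  assumes c: "c \<notin> \<int>\<^sub>\<le>\<^sub>0"
  shows "gauss_continuable a b c n"
proof -
  \<comment> \<open>Continuability concerns the parameters only, so any admissible point serves for
    the instantiation.\<close>
  interpret Z: below_one 0 by standard simp
  obtain M1 where M1: "\<And>m. m \<ge> M1 \<Longrightarrow> \<exists>f. has_2f1_continuation (a + of_nat m) (b + of_nat m) (c + 2 * of_nat m) f"
    using Z.hyp2f1_half_rate(2)[of a b c] unfolding eventually_sequentially by blast
  obtain M2 where M2: "\<And>m. m \<ge> M2 \<Longrightarrow> \<exists>f. has_2f1_continuation (a + 1 + of_nat m) (b + of_nat m) (c + 1 + 2 * of_nat m) f"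
    using Z.hyp2f1_half_rate(2)[of "a + 1" b "c + 1"] unfolding eventually_sequentially by blast
  have far: "gauss_continuable a b c k" if k: "k \<ge> 2 * M1 + 2 * M2" for k
  proof (cases "even k")
    case True
    then obtain m where m: "k = 2 * m" by blast
    then show ?thesis using M1[of m] k by (simp add: gauss_continuable_def)
  next
    case False
    then obtain m where m: "k = 2 * m + 1" using oddE by blast
    then show ?thesis using M2[of m] k by (simp add: gauss_continuable_def add_ac)
  qed
  have "gauss_continuable a b c k \<and> gauss_continuable a b c (Suc k)" if "k \<le> 2 * M1 + 2 * M2" for k
    using that
  proof (induction k rule: inc_induct)
    case base
    show ?case using far by simp
  next
    case (step k)
    then show ?case using gauss_contiguous_step(1)[OF c] by blast
  qed
  then show ?thesis using far by (meson linear)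
qed

corollary gauss_recurrence:
  assumes "c \<notin> \<int>\<^sub>\<le>\<^sub>0" "z \<in> cut_plane"
  shows "gauss_numerator a b c n z = gauss_numerator a b c (Suc n) z
         + gauss_cf_coeff a b c z (Suc n) * gauss_numerator a b c (Suc (Suc n)) z"
  using gauss_contiguous_step(2) gauss_continuable_all assms by blast

lemma gauss_numerator_at_zero:
  assumes "c \<notin> \<int>\<^sub>\<le>\<^sub>0"
  shows "gauss_numerator a b c n 0 = 1"
proof -
  have "gauss_numerator a b c n 0 = hyp2f1_series (a + of_nat (Suc n div 2)) (b + of_nat (n div 2)) (c + of_nat n) 0"
    using gauss_continuable_all[OF assms, of a b n] has_2f1_continuation_hyp2f1
    unfolding gauss_continuable_def gauss_numerator_def has_2f1_continuation_def
    by (metis centre_in_ball zero_less_one)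
  also have "\<dots> = 1"
    unfolding hyp2f1_series_def by (subst powser_zero) simp
  finally show ?thesis .
qed

lemma finite_cf_first_only:
  assumes "\<And>k. k > 0 \<Longrightarrow> R k = 0"
  shows "finite_cf R n = R 0"
proof -
  have "foldr (\<lambda>k t. R k / (1 + t)) [1..<Suc n] 0 = 0"
    using assms by (cases n) (simp_all add: upt_conv_Cons del: upt_Suc)
  then show ?thesis by (simp add: finite_cf_def upt_conv_Cons del: upt_Suc)
qed

context below_one
begin

text \<open>Odd indices correspond to the parameters (a + 1, b, c + 1): c - a - b is unchanged, and
  the additional factor 1 + w in the limit is used up by the odd power in the denominator. Hence
  both parities share one limit.\<close>

lemma gauss_numerator_half_rate:
  "half_rate (\<lambda>n. gauss_numerator a b c n (of_real z) / (1 + of_real w) ^ n)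
      ((1 + of_real w) powr (c - 1) * of_real s powr (c - a - b - 1 / 2))" (is "half_rate _ ?D")
proof (rule half_rate_parity)
  define W where "W = 1 + complex_of_real w"
  have W: "W \<noteq> 0"
  proof -
    have "1 + w \<noteq> 0" using w(1) by auto
    then show ?thesis unfolding W_def by (metis of_real_1 of_real_add of_real_eq_0_iff)
  qed
  show "half_rate (\<lambda>m. gauss_numerator a b c (2 * m) (of_real z) / (1 + of_real w) ^ (2 * m)) ?D"
    unfolding gauss_numerator_even by (rule hyp2f1_half_rate)
  have lim: "half_rate (\<lambda>m. gauss_numerator a b c (2 * m + 1) (of_real z) / W ^ (2 * m) / W)
      (W powr (c + 1 - 1) * of_real s powr ((c + 1) - (a + 1) - b - 1 / 2) / W)"
    unfolding gauss_numerator_odd W_def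
    using W by (intro half_rate_divide hyp2f1_half_rate half_rate_const) (auto simp: W_def)
  have pw: "W powr (c + 1 - 1) * S / W = W powr (c - 1) * S" for S using W by (simp add: powr_diff)
  have den: "S / W ^ (2 * m) / W = S / W ^ (2 * m + 1)" for S m by (simp add: mult.commute)
  have ex: "c + 1 - (a + 1) - b - 1 / 2 = c - a - b - 1 / 2" by simp
  from lim show "half_rate (\<lambda>m. gauss_numerator a b c (2 * m + 1) (of_real z) / (1 + of_real w) ^ (2 * m + 1)) ?D"
    unfolding W_def[symmetric] pw den ex .
qed

end

theorem theorem1p1:
  fixes a b c :: complex and z :: real
  assumes "a \<notin> of_int ` {..-1}"
    and "c - b \<notin> of_int ` {..-1}"
    and "b \<notin> \<int>\<^sub>\<le>\<^sub>0"
    and "c \<notin> \<int>\<^sub>\<le>\<^sub>0"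
    and "c - a \<notin> \<int>\<^sub>\<le>\<^sub>0"
    and "z < 1"
    and "hyp2f1 a b c (of_real z) \<noteq> 0"
  shows "asymp_half
     (\<lambda>n. gauss_cf_error n a b c (of_real z))
     (\<lambda>n. of_real (2 * pi) / (hyp2f1 a b c (of_real z))\<^sup>2
          * (Gamma c * Gamma (c + 1)
             / (Gamma (a + 1) * Gamma b * Gamma (c - a) * Gamma (c - b + 1)))
          * (of_real z * of_real (1 - z) powr (c - a - b)
             / of_real (1 + sqrt (1 - z)) powr (2 * (c + 1)))
          * of_real (z / (1 + sqrt (1 - z))\<^sup>2) ^ n)"
proof -
  interpret below_one z using assms(6) by unfold_locales
  define x where "x = complex_of_real z"
  define f where "f n = gauss_numerator a b c n x" for n
  define R where "R = gauss_cf_coeff a b c x"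
  have f01: "f 0 = hyp2f1 a b c x" "f 1 = hyp2f1 (a + 1) b (c + 1) x"
    by (simp_all add: f_def gauss_numerator_def)
  have err: "gauss_cf_error n a b c x = f 1 / f 0 - finite_cf R n" for n
    by (simp only: gauss_cf_error_def f01 R_def)
  show ?thesis
  \<comment> \<open>For z = 0 the comparison sequence vanishes identically, so the error has to be
    shown to be exactly 0.\<close>
  proof (cases "z = 0")
    case True
    have "R k = 0" if "k > 0" for k
      using that by (cases k) (simp_all add: R_def x_def True Let_def)
    then have "finite_cf R n = 1" for n
      using finite_cf_first_only[of R n] by (simp add: R_def)
    moreover have "f k = 1" for k
      using gauss_numerator_at_zero[OF assms(4)] by (simp add: f_def x_def True)
    ultimately have "gauss_cf_error n a b c x = 0" for n
      unfolding err by simp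
    then show ?thesis by (simp add: asymp_half_def x_def True)
  next
    case z0: False
    have x0: "x \<noteq> 0" using z0 by (simp add: x_def)
    have shift: "y + 1 \<notin> \<int>\<^sub>\<le>\<^sub>0" if "y \<notin> of_int ` {..-1}" for y :: complex
    proof
      assume "y + 1 \<in> \<int>\<^sub>\<le>\<^sub>0"
      then obtain k where k: "k \<le> 0" "y + 1 = of_int k" by (elim nonpos_Ints_cases)
      then have "y = of_int (k - 1)" by (simp add: eq_diff_eq)
      then have "y \<in> of_int ` {..-1}" using k(1) by (intro image_eqI[of _ _ "k - 1"]) auto
      then show False using that by blast
    qed
    have a1: "a + 1 \<notin> \<int>\<^sub>\<le>\<^sub>0" and cb1: "c - b + 1 \<notin> \<int>\<^sub>\<le>\<^sub>0" using assms(1,2) shift by blast+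
    have c1: "c + 1 \<notin> \<int>\<^sub>\<le>\<^sub>0" using nonpos_Ints_add_of_nat[OF assms(4), of 1] by simp
    have nz: "y + of_nat n \<noteq> 0" if "y \<notin> \<int>\<^sub>\<le>\<^sub>0" for y :: complex and n
      using nonpos_Ints_add_of_nat[OF that, of n] by auto
    define D where "D = (1 + of_real w) powr (c - 1) * of_real s powr (c - a - b - 1 / 2)"
    have w1: "1 + w > 0" "1 - w > 0" using w(1) by auto
    have W: "1 + complex_of_real w = of_real (1 + w)" by simp
    have D: "D \<noteq> 0" unfolding D_def W using w1 s(1) by (simp del: of_real_add)
    interpret convergent_cf R f w D
    proof
      show "f n = f (Suc n) + R (Suc n) * f (Suc (Suc n))" for n
        unfolding f_def R_def using of_real_in_cut_plane[OF z] assms(4)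
        by (intro gauss_recurrence) (auto simp: x_def)
      show "R 0 = 1" by (simp add: R_def)
      \<comment> \<open>The conditions on the parameters enter here: those on a and c - b for even
        indices, those on b and c - a for odd ones, and the one on c for the denominators.\<close>
      show "R n \<noteq> 0" if "n > 0" for n
      proof (cases "even n")
        case True
        then obtain k where k: "n = 2 * k" by blast
        define m where "m = k - 1"
        have m: "n = Suc (2 * m + 1)" using k that by (simp add: m_def)
        have "a + 1 + of_nat m \<noteq> 0" using a1 by (rule nz)
        moreover have "c + 1 + 2 * of_nat m - (b + of_nat m) \<noteq> 0"
          using nz[OF cb1, of m] by (simp add: algebra_simps)
        moreover have "c + 1 + 2 * of_nat m \<noteq> 0" using nz[OF c1, of "2 * m"] by simp
        moreover have "c + 1 + 2 * of_nat m + 1 \<noteq> 0" using nz[OF c1, of "2 * m + 1"] by (simp add: add_ac)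
        ultimately show ?thesis
          unfolding R_def m gauss_cf_coeff_Suc_odd using x0 by simp
      next
        case False
        then obtain m where m: "n = Suc (2 * m)" by (auto elim: oddE)
        have "b + of_nat m \<noteq> 0" using assms(3) by (rule nz)
        moreover have "c + 2 * of_nat m - (a + of_nat m) \<noteq> 0"
          using nz[OF assms(5), of m] by (simp add: algebra_simps)
        moreover have "c + 2 * of_nat m \<noteq> 0" using nz[OF assms(4), of "2 * m"] by simp
        moreover have "c + 2 * of_nat m + 1 \<noteq> 0" using nz[OF assms(4), of "2 * m + 1"] by (simp add: add_ac)
        ultimately show ?thesis
          unfolding R_def m gauss_cf_coeff_Suc_even using x0 by simp
      qed
      show "\<bar>w\<bar> < 1" by (rule w)
      have "- complex_of_real w / (1 + of_real w)\<^sup>2 = of_real (- (w / (1 + w)\<^sup>2))" by simp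
      also have "\<dots> = - x / 4" unfolding w(4) by (simp add: x_def)
      finally have lim: "- complex_of_real w / (1 + of_real w)\<^sup>2 = - x / 4" .
      show "half_rate R (- of_real w / (1 + of_real w)\<^sup>2)"
        unfolding R_def lim by (rule gauss_cf_coeff_half_rate)
      show "half_rate (\<lambda>n. f n / (1 + of_real w) ^ n) D"
        unfolding f_def x_def D_def by (rule gauss_numerator_half_rate)
      show "D \<noteq> 0" by (rule D)
    qed
    define G where "G = Gamma c * Gamma (c + 1) / (Gamma (a + 1) * Gamma b * Gamma (c - a) * Gamma (c - b + 1))"
    have G: "G \<noteq> 0"
      unfolding G_def using assms a1 cb1 c1 by (simp add: Gamma_eq_zero_iff)
    define L where "L = of_real (2 * pi) / 4 powr c * G"
    define \<Lambda> where "\<Lambda> = L * (D\<^sup>2 * (1 - of_real w) / (f 0)\<^sup>2)"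
    have f0: "f 0 \<noteq> 0" using assms(7) by (simp add: f01 x_def)
    have \<Lambda>: "\<Lambda> \<noteq> 0"
    proof -
      have "1 - complex_of_real w = of_real (1 - w)" by simp
      then have "1 - complex_of_real w \<noteq> 0" using w1 by (simp only: of_real_eq_0_iff)
      then show ?thesis using G D f0 by (simp add: \<Lambda>_def L_def)
    qed
    \<comment> \<open>The comparison sequence as the general error formula delivers it, in terms of
      w; it is rewritten below in terms of z.\<close>
    define \<beta> where "\<beta> n = \<Lambda> * (x / 4) ^ Suc n * (1 + of_real w) ^ (2 * n + 3)" for n
    have Wnz: "1 + complex_of_real w \<noteq> 0" by (rule w_nz)
    have \<beta>_nz: "\<beta> n \<noteq> 0" for n using \<Lambda> x0 Wnz by (simp add: \<beta>_def)
    have prod: "half_rate (\<lambda>n. (\<Prod>i=1..Suc n. - R i) / (x / 4) ^ Suc n) L"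
      using half_rate_offset[OF gauss_cf_coeff_prod_half_rate[OF x0 assms(4), of a b], of 1]
      unfolding L_def G_def R_def by (simp del: prod.cl_ivl_Suc)
    have ratio: "half_rate (\<lambda>n. gauss_cf_error n a b c x / \<beta> n) 1"
    proof -
      have "half_rate (\<lambda>n. ((\<Prod>i=1..Suc n. - R i) / (x / 4) ^ Suc n)
          * ((f 1 / f 0 - finite_cf R n) / ((\<Prod>i=1..Suc n. - R i) * (1 + of_real w) ^ (2 * n + 3))) / \<Lambda>) (\<Lambda> / \<Lambda>)"
        unfolding \<Lambda>_def by (intro half_rate_divide half_rate_mult prod error_asymptotics f0 half_rate_const)
          (use \<Lambda> in \<open>simp add: \<Lambda>_def\<close>)
      moreover have "((\<Prod>i=1..Suc n. - R i) / (x / 4) ^ Suc n)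
          * ((f 1 / f 0 - finite_cf R n) / ((\<Prod>i=1..Suc n. - R i) * (1 + of_real w) ^ (2 * n + 3))) / \<Lambda>
          = gauss_cf_error n a b c x / \<beta> n" for n
      proof -
        define P where "P = (\<Prod>i=1..Suc n. - R i)"
        have "P \<noteq> 0" using R_nz by (auto simp: P_def)
        then show ?thesis unfolding P_def[symmetric] err \<beta>_def by (simp add: mult_ac)
      qed
      ultimately show ?thesis using \<Lambda> by simp
    qed
    have "of_real (2 * pi) / (hyp2f1 a b c (of_real z))\<^sup>2
          * (Gamma c * Gamma (c + 1)
             / (Gamma (a + 1) * Gamma b * Gamma (c - a) * Gamma (c - b + 1)))
          * (of_real z * of_real (1 - z) powr (c - a - b)
             / of_real (1 + sqrt (1 - z)) powr (2 * (c + 1)))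
          * of_real (z / (1 + sqrt (1 - z))\<^sup>2) ^ n = \<beta> n" for n
    proof -
      define V where "V = 1 + w"
      define h where "h = (c - a - b) * of_real (ln (1 - z))"
      have V: "V > 0" "V = 2 / (1 + s)" using w1 w(2) by (simp_all add: V_def t0_def)
      have s1: "1 + s > 0" using s(1) by simp
      have lnV: "ln V = ln 2 - ln (1 + s)" unfolding V(2) using s1 by (simp add: ln_div)
      have lns: "ln s = ln (1 - z) / 2" unfolding s_def using z by (simp add: ln_sqrt)
      have ln4: "ln (4::real) = 2 * ln 2" using ln_realpow[of 2 2] by simp
      have exps: "complex_of_real V = exp (of_real (ln V))" "complex_of_real s = exp (of_real (ln s))"
        using V(1) s(1) by (simp_all add: exp_of_real)
      \<comment> \<open>Since 1 - w = s V, the exponents add up to 2 c for V and 2 (c - a - b) for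
        s. Then V / 2 = 1 / (1 + s) absorbs the power of 4, and s^2 = 1 - z.\<close>
      have "D\<^sup>2 * (1 - of_real w) * of_real V / 4 powr c
          = of_real (1 - z) powr (c - a - b) / of_real (1 + s) powr (2 * c)"
      proof -
        have "1 - complex_of_real w = of_real (s * V)"
          unfolding V_def w(3)[symmetric] by simp
        then have "1 - complex_of_real w = exp (of_real (ln s) + of_real (ln V))"
          by (simp add: exp_add exps[symmetric])
        moreover have "4 powr c = exp (c * of_real (ln 4))"
          using of_real_powr_eq_exp[of 4 c] by simp
        moreover have "D = exp ((c - 1) * of_real (ln V) + (c - a - b - 1 / 2) * of_real (ln s))"
          unfolding D_def W V_def[symmetric] using V(1) s(1) by (simp add: of_real_powr_eq_exp exp_add)
        ultimately have "D\<^sup>2 * (1 - of_real w) * of_real V / 4 powr c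
          = exp (((c - 1) * of_real (ln V) + (c - a - b - 1 / 2) * of_real (ln s)) + ((c - 1) * of_real (ln V) + (c - a - b - 1 / 2) * of_real (ln s))
             + (of_real (ln s) + of_real (ln V)) + of_real (ln V) - c * of_real (ln 4))"
          by (simp only: exps(1) power2_eq_square exp_add[symmetric] exp_diff[symmetric])
        also have "((c - 1) * of_real (ln V) + (c - a - b - 1 / 2) * of_real (ln s)) + ((c - 1) * of_real (ln V) + (c - a - b - 1 / 2) * of_real (ln s))
             + (of_real (ln s) + of_real (ln V)) + of_real (ln V) - c * complex_of_real (ln 4)
             = (c - a - b) * of_real (ln (1 - z)) - (2 * c) * of_real (ln (1 + s))"
          unfolding lnV lns ln4 by (simp add: field_simps)
        also have "exp \<dots> = of_real (1 - z) powr (c - a - b) / of_real (1 + s) powr (2 * c)"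
          using s1 z by (simp only: of_real_powr_eq_exp exp_diff diff_gt_0_iff_gt)
        finally show ?thesis .
      qed
      \<comment> \<open>Of the 2 n + 3 factors V one was used above; the others pair with the
        factors x / 4, where V^2 / 4 = 1 / (1 + s)^2.\<close>
      moreover have "(x / 4) ^ Suc n * of_real V ^ (2 * n + 2) = of_real (z / (1 + s)\<^sup>2) ^ Suc n"
      proof -
        have "2 * n + 2 = 2 * Suc n" by simp
        then have "(x / 4) ^ Suc n * of_real V ^ (2 * n + 2) = (x / 4 * (of_real V)\<^sup>2) ^ Suc n"
          by (simp only: power_mult power_mult_distrib)
        also have "x / 4 * (of_real V)\<^sup>2 = of_real (z / (1 + s)\<^sup>2)"
          unfolding V(2) x_def by (simp add: power_divide)
        finally show ?thesis .
      qed
      \<comment> \<open>The power of z / (1 + s)^2 obtained is n + 1 instead of n; the surplus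
        factor supplies the isolated z and raises the exponent 2 c to 2 (c + 1).\<close>
      moreover have "of_real (1 + s) powr (2 * (c + 1)) = of_real (1 + s) powr (2 * c) * (complex_of_real (1 + s))\<^sup>2"
      proof -
        have e: "2 * (c + 1) = 2 * c + of_nat 2" by simp
        have "complex_of_real (1 + s) \<noteq> 0" using s1 by (simp only: of_real_eq_0_iff)
        then show ?thesis unfolding e powr_add by (subst powr_complexpow) simp_all
      qed
      moreover have "\<beta> n = of_real (2 * pi) * G / (f 0)\<^sup>2 * (D\<^sup>2 * (1 - of_real w) * of_real V / 4 powr c)
          * ((x / 4) ^ Suc n * of_real V ^ (2 * n + 2))"
      proof -
        have "complex_of_real V ^ (2 * n + 3) = of_real V * of_real V ^ (2 * n + 2)"
          by (simp add: numeral_3_eq_3)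
        then show ?thesis unfolding \<beta>_def \<Lambda>_def L_def W V_def[symmetric] by (simp add: mult_ac)
      qed
      ultimately have "\<beta> n = of_real (2 * pi) * G / (f 0)\<^sup>2
          * (of_real (1 - z) powr (c - a - b) / of_real (1 + s) powr (2 * c)) * of_real (z / (1 + s)\<^sup>2) ^ Suc n"
        and e: "of_real (1 + s) powr (2 * (c + 1)) = of_real (1 + s) powr (2 * c) * (complex_of_real (1 + s))\<^sup>2"
        by simp_all
      then show ?thesis
        unfolding s_def[symmetric] G_def[symmetric] f01[folded x_def, symmetric] x_def[symmetric] e
        by (simp add: f01 x_def mult_ac)
    qed
    then have \<beta>: "(\<lambda>n. of_real (2 * pi) / (hyp2f1 a b c (of_real z))\<^sup>2
          * (Gamma c * Gamma (c + 1)
             / (Gamma (a + 1) * Gamma b * Gamma (c - a) * Gamma (c - b + 1)))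
          * (of_real z * of_real (1 - z) powr (c - a - b)
             / of_real (1 + sqrt (1 - z)) powr (2 * (c + 1)))
          * of_real (z / (1 + sqrt (1 - z))\<^sup>2) ^ n) = \<beta>"
      by (rule ext)
    \<comment> \<open>As \<open>\<beta>\<close> never vanishes, the branch of
      \<open>asymp_half\<close> with the quotient applies.\<close>
    have "asymp_half (\<lambda>n. gauss_cf_error n a b c x) \<beta>"
      unfolding asymp_half_def using \<beta>_nz ratio[unfolded half_rate_complex] by simp
    then show ?thesis
      unfolding \<beta> x_def .
  qed
qed

end
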